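(* Let $A_0\in\mathfrak{gl}_n(\mathbb{R})$ with $\operatorname{tr}(A_0)=0$ and $A_0$ not nilpotent. Let $\mu_{A(t)}$ be the bracket flow starting at $\mu_{A_0}$ and let $\bar A(t)$ be the solution, starting at $\bar A(0)=A_0$, of the negative gradient flow of the functional $F(A)=\|[A,A^t]\|^2$ on $\mathfrak{gl}_n(\mathbb{R})$, that is, $\frac{d}{dt}\bar A(t)=4[\bar A(t),[\bar A(t),\bar A(t)^t]]$. Then the limit of $\frac{A(t)}{\|A(t)\|}$ as $t\to\infty$ exists and $$\lim_{t\to\infty}\frac{A(t)}{\|A(t)\|}=\lim_{t\to\infty}\frac{\bar A(t)}{\|\bar A(t)\|}.$$
   Context: $\mathfrak{gl}_n(\mathbb{R})$ carries the inner product $\langle A,B\rangle=\operatorname{tr}(AB^t)$, with norm $\|A\|^2=\operatorname{tr}(AA^t)$. For $A\in\mathfrak{gl}_n(\mathbb{R})$, $\mu_A$ is the Lie bracket on $\mathbb{R}^{n+1}=\mathbb{R}e_0\oplus\mathbb{R}^n$ given by $\mu_A(e_0,e_i)=Ae_i$ and $\mu_A(e_i,e_j)=0$ for $i,j\ge1$. The bracket flow starting at $\mu_{A_0}$ is $\mu_{A(t)}$, where $A(t)$ is the solution (defined for all $t\ge0$) of $$\tfrac{d}{dt}A=-\operatorname{tr}(S(A)^2)A+\tfrac12[A,[A,A^t]]-\tfrac12\operatorname{tr}(A)[A,A^t],\quad A(0)=A_0,\qquad S(A)=\tfrac12(A+A^t).$$ *)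

theory Defs
  imports "HOL-Analysis.Analysis"
begin

text \<open>
  Elements of \<open>\<g>\<l>\<^sub>n(\<real>)\<close> are matrices of type \<open>real ^ 'n ^ 'n\<close>. The inner product and norm of this
  type are the entrywise ones; the next two lemmas identify them with the trace form and the
  Frobenius norm.
\<close>

lemma inner_matrix_eq_trace:
  fixes A B :: "real ^ 'n ^ 'n"
  shows "A \<bullet> B = trace (A ** transpose B)"
  by (simp add: inner_vec_def trace_def matrix_matrix_mult_def transpose_def)

lemma norm_matrix_eq_trace:
  fixes A :: "real ^ 'n ^ 'n"
  shows "(norm A)\<^sup>2 = trace (A ** transpose A)"
  by (simp add: inner_matrix_eq_trace[symmetric] power2_norm_eq_inner)

definition commutator :: "real ^ 'n ^ 'n \<Rightarrow> real ^ 'n ^ 'n \<Rightarrow> real ^ 'n ^ 'n" where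
  "commutator A B = A ** B - B ** A"

text \<open>The operation \<open>*\<close> (hence \<open>^\<close>) on \<open>real ^ 'n ^ 'n\<close> is entrywise, so powers are iterated \<open>**\<close>.\<close>

definition nilpotent_matrix :: "real ^ 'n ^ 'n \<Rightarrow> bool" where
  "nilpotent_matrix A \<longleftrightarrow> (\<exists>k. (((**) A) ^^ k) (mat 1) = 0)"

definition sym_part :: "real ^ 'n ^ 'n \<Rightarrow> real ^ 'n ^ 'n" where
  "sym_part A = (1 / 2) *\<^sub>R (A + transpose A)"

text \<open>
  \<open>\<real>\<^bsup>n+1\<^esup> = \<real>e\<^sub>0 \<oplus> \<real>\<^sup>n\<close> is rendered as \<open>real \<times> (real ^ 'n)\<close>, with \<open>e\<^sub>0 = (1, 0)\<close> and
  \<open>e\<^sub>i = (0, axis i 1)\<close>; \<open>lie_mu A\<close> is the bilinear alternating extension of the values on this basis.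
\<close>

definition lie_mu ::
    "real ^ 'n ^ 'n \<Rightarrow> real \<times> (real ^ 'n) \<Rightarrow> real \<times> (real ^ 'n) \<Rightarrow> real \<times> (real ^ 'n)" where
  "lie_mu A u v = (0, fst u *\<^sub>R (A *v snd v) - fst v *\<^sub>R (A *v snd u))"

lemma lie_mu_e0: "lie_mu A (1, 0) (0, axis i 1) = (0, A *v axis i 1)"
  by (simp add: lie_mu_def)

lemma lie_mu_ij: "lie_mu A (0, axis i 1) (0, axis j 1) = 0"
  by (simp add: lie_mu_def zero_prod_def)

lemma lie_mu_alternating: "lie_mu A u u = 0"
  by (simp add: lie_mu_def zero_prod_def)

lemma bilinear_lie_mu: "bilinear (lie_mu A)"
  unfolding bilinear_def
  by (auto intro!: linearI simp: lie_mu_def algebra_simps matrix_vector_mult_scaleR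
        matrix_vector_right_distrib)

lemma lie_mu_jacobi:
  "lie_mu A u (lie_mu A v w) + lie_mu A v (lie_mu A w u) + lie_mu A w (lie_mu A u v) = 0"
  by (simp add: lie_mu_def zero_prod_def algebra_simps matrix_vector_mult_scaleR
        matrix_vector_right_distrib matrix_vector_mult_diff_distrib)

lemma lie_mu_inject: "lie_mu A = lie_mu B \<longleftrightarrow> A = B"
proof
  assume eq: "lie_mu A = lie_mu B"
  have "A *v x = B *v x" for x
    using fun_cong[OF fun_cong[OF eq, of "(1, 0)"], of "(0, x)"] by (simp add: lie_mu_def)
  then show "A = B"
    by (simp add: matrix_eq)
qed simp

definition bracket_flow_rhs :: "real ^ 'n ^ 'n \<Rightarrow> real ^ 'n ^ 'n" where
  "bracket_flow_rhs A =
     - trace (sym_part A ** sym_part A) *\<^sub>R A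
     + (1 / 2) *\<^sub>R commutator A (commutator A (transpose A))
     - (1 / 2 * trace A) *\<^sub>R commutator A (transpose A)"

text \<open>
  Curves are functions of \<open>t :: real\<close>, but only their restriction to \<open>t \<ge> 0\<close> is constrained; at
  \<open>t = 0\<close> the derivative is one-sided.
\<close>

definition is_bracket_flow ::
    "(real \<Rightarrow> real \<times> (real ^ 'n) \<Rightarrow> real \<times> (real ^ 'n) \<Rightarrow> real \<times> (real ^ 'n))
     \<Rightarrow> (real \<times> (real ^ 'n) \<Rightarrow> real \<times> (real ^ 'n) \<Rightarrow> real \<times> (real ^ 'n)) \<Rightarrow> bool" where
  "is_bracket_flow m m0 \<longleftrightarrow>
     (\<exists>A. lie_mu (A 0) = m0 \<and>
          (\<forall>t\<ge>0. m t = lie_mu (A t)) \<and>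
          (\<forall>t\<ge>0. (A has_vector_derivative bracket_flow_rhs (A t)) (at t within {0..})))"

definition is_neg_gradient_flow :: "('a::real_inner \<Rightarrow> real) \<Rightarrow> (real \<Rightarrow> 'a) \<Rightarrow> bool" where
  "is_neg_gradient_flow F B \<longleftrightarrow>
     (\<exists>G. (\<forall>x. GDERIV F x :> G x) \<and>
          (\<forall>t\<ge>0. (B has_vector_derivative - G (B t)) (at t within {0..})))"

definition comm_functional :: "real ^ 'n ^ 'n \<Rightarrow> real" where
  "comm_functional A = (norm (commutator A (transpose A)))\<^sup>2"

lemma transpose_diff: "transpose (A - B) = transpose A - transpose (B :: real ^ 'n ^ 'm)"
  by (simp add: transpose_def vec_eq_iff)

lemma transpose_commutator:
  "transpose (commutator A B) = commutator (transpose B) (transpose A)"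
  by (simp add: commutator_def transpose_diff matrix_transpose_mul)

lemma inner_transpose:
  fixes A B :: "real ^ 'n ^ 'n"
  shows "transpose A \<bullet> transpose B = A \<bullet> B"
  unfolding inner_vec_def transpose_def by (simp, rule sum.swap)

lemma inner_mult_right:
  fixes H Y C :: "real ^ 'n ^ 'n"
  shows "(H ** Y) \<bullet> C = H \<bullet> (C ** transpose Y)"
  by (simp add: inner_matrix_eq_trace matrix_transpose_mul matrix_mul_assoc)

lemma inner_mult_left:
  fixes H Y C :: "real ^ 'n ^ 'n"
  shows "(Y ** H) \<bullet> C = H \<bullet> (transpose Y ** C)"
proof -
  have "(Y ** H) \<bullet> C = (transpose H ** transpose Y) \<bullet> transpose C"
    by (simp add: matrix_transpose_mul[symmetric] inner_transpose)
  also have "\<dots> = transpose H \<bullet> transpose (transpose Y ** C)"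
    by (simp add: inner_mult_right matrix_transpose_mul)
  also have "\<dots> = H \<bullet> (transpose Y ** C)"
    by (rule inner_transpose)
  finally show ?thesis .
qed

lemma bounded_bilinear_commutator:
  "bounded_bilinear (commutator :: real ^ 'n ^ 'n \<Rightarrow> _)"
  unfolding bilinear_conv_bounded_bilinear[symmetric] bilinear_def
proof (intro conjI allI linearI)
  have rdistrib: "(A + B) ** C = A ** C + B ** C" for A B C :: "real ^ 'n ^ 'n"
    by (simp add: vec_eq_iff matrix_matrix_mult_def distrib_right sum.distrib)
  show "commutator A (B + C) = commutator A B + commutator A C"
    "commutator (B + C) A = commutator B A + commutator C A" for A B C :: "real ^ 'n ^ 'n"
    by (simp_all add: commutator_def matrix_add_ldistrib rdistrib)
  show "commutator A (c *\<^sub>R B) = c *\<^sub>R commutator A B"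
    "commutator (c *\<^sub>R B) A = c *\<^sub>R commutator B A" for c and A B :: "real ^ 'n ^ 'n"
    by (simp_all add: commutator_def matrix_scalar_ac scalar_matrix_assoc[symmetric]
        scaleR_right_diff_distrib)
qed

lemma bounded_linear_transpose:
  "bounded_linear (transpose :: real ^ 'n ^ 'n \<Rightarrow> _)"
  unfolding linear_conv_bounded_linear[symmetric]
  by (auto intro!: linearI simp: transpose_def vec_eq_iff)

lemma GDERIV_comm_functional:
  fixes X :: "real ^ 'n ^ 'n"
  shows "GDERIV comm_functional X :> - 4 *\<^sub>R commutator X (commutator X (transpose X))"
proof -
  define C where "C = commutator X (transpose X)"
  have symC: "transpose C = C"
    by (simp add: C_def transpose_commutator)
  have h1: "C \<bullet> commutator h (transpose X) = - (h \<bullet> commutator X C)" for h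
    by (simp add: inner_commute[of C] commutator_def[of h] commutator_def[of X C]
          inner_diff_left inner_diff_right inner_mult_right[of h] inner_mult_left[of _ h])
  have h2: "C \<bullet> commutator X (transpose h) = - (h \<bullet> commutator X C)" for h
    using inner_transpose[of C "commutator h (transpose X)"] h1[of h]
    by (simp add: symC transpose_commutator)
  have tr: "(transpose has_derivative transpose) (at X)"
    using bounded_linear_transpose by (rule bounded_linear_imp_has_derivative)
  have dC: "((\<lambda>X. commutator X (transpose X)) has_derivative
      (\<lambda>h. commutator X (transpose h) + commutator h (transpose X))) (at X)"
    by (rule bounded_bilinear.FDERIV[OF bounded_bilinear_commutator has_derivative_ident tr])
  have "(comm_functional has_derivative
      (\<lambda>h. C \<bullet> (commutator X (transpose h) + commutator h (transpose X))
         + (commutator X (transpose h) + commutator h (transpose X)) \<bullet> C)) (at X)"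
    unfolding comm_functional_def power2_norm_eq_inner C_def
    by (rule has_derivative_inner[OF dC dC])
  then show ?thesis
    unfolding gderiv_def C_def[symmetric]
    by (rule has_derivative_subst)
      (simp add: fun_eq_iff inner_commute[of _ C] inner_add_right h1 h2)
qed

lemma neg_gradient_flow_comm_functional_iff:
  fixes B :: "real \<Rightarrow> real ^ 'n ^ 'n"
  shows "is_neg_gradient_flow comm_functional B \<longleftrightarrow>
     (\<forall>t\<ge>0. (B has_vector_derivative
        4 *\<^sub>R commutator (B t) (commutator (B t) (transpose (B t)))) (at t within {0..}))"
proof -
  have uniq: "D = - 4 *\<^sub>R commutator x (commutator x (transpose x))"
    if "GDERIV comm_functional x :> D" for x D :: "real ^ 'n ^ 'n"
  proof -
    have "(\<lambda>h. h \<bullet> D) = (\<lambda>h. h \<bullet> (- 4 *\<^sub>R commutator x (commutator x (transpose x))))"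
      by (rule has_derivative_unique[OF that[unfolded gderiv_def]
            GDERIV_comm_functional[unfolded gderiv_def]])
    then show ?thesis
      using vector_eq_ldot by metis
  qed
  define G0 :: "real ^ 'n ^ 'n \<Rightarrow> _"
    where "G0 x = - 4 *\<^sub>R commutator x (commutator x (transpose x))" for x
  have G_iff: "(\<forall>x. GDERIV comm_functional x :> G x) \<longleftrightarrow> G = G0" for G
    using uniq GDERIV_comm_functional unfolding G0_def fun_eq_iff by metis
  show ?thesis
    by (simp add: is_neg_gradient_flow_def G_iff G0_def)
qed

end

theory Submission
  imports Defs "HOL-Computational_Algebra.Fundamental_Theorem_Algebra"
begin

text \<open>
  Every commutator has trace zero, so the bracket flow keeps the trace zero and solves
  \<open>A' = - s A + 1/2 [A, [A, A\<^sup>t]]\<close> with \<open>s \<ge> 0\<close> the squared norm of the symmetric part. The double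
  bracket is homogeneous of degree three, so such a curve is a rescaling and
  reparametrisation \<open>A t = c t *\<^sub>R B (\<tau> t)\<close> of the solution \<open>B\<close> of \<open>B' = 4 [B, [B, B\<^sup>t]]\<close>, with \<open>c > 0\<close>
  and \<open>\<tau> \<rightarrow> \<infinity>\<close> (\<open>bracket_flow_eq_rescaled_gradient_flow\<close>). Normalising removes \<open>c\<close>, and the claim
  follows once \<open>B\<close> is known to converge to a nonzero limit (\<open>neg_gradient_flow_converges\<close>).

  Convergence of a gradient flow needs a gradient inequality of Lojasiewicz type. Here one can be
  proved by hand, with exponent 3/4. Let \<open>C = [A, A\<^sup>*]\<close>. One has \<open>\<langle>[A, C], A\<rangle> = - \<parallel>C\<parallel>\<^sup>2\<close>, while
  \<open>\<langle>[A, C], D\<rangle> = 0\<close> whenever \<open>D\<^sup>*\<close> commutes with \<open>A\<close>. Hence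
  \<open>\<parallel>C\<parallel>\<^sup>2 \<le> \<parallel>[A, C]\<parallel> \<parallel>A - D\<parallel>\<close>, and it pays to choose
  \<open>D\<^sup>* = p(A)\<close> as near to \<open>A\<^sup>*\<close> as possible. The flow moves \<open>A\<close> by infinitesimal conjugations, so a
  polynomial \<open>q\<close> with \<open>q(A) = 0\<close> at time zero annihilates \<open>A\<close> for ever, and a fixed \<open>p\<close> that interpolates
  complex conjugation on the roots of \<open>q\<close> serves for the whole curve. If \<open>A\<close> were normal, \<open>p(A)\<close> would
  equal \<open>A\<^sup>*\<close>. In general \<open>A\<close> is block triangular, with scalar diagonal blocks, in an orthogonal
  decomposition adapted to the kernels of the partial products of \<open>q\<close>, and Henrici's estimate bounds
  the blocks off the diagonal by a multiple of \<open>\<parallel>C\<parallel>\<^bsup>1/2\<^esup>\<close>; so \<open>\<parallel>A\<^sup>* - p(A)\<parallel>\<close> is at most a multiple of \<open>\<parallel>C\<parallel>\<^bsup>1/2\<^esup>\<close>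
  (\<open>adjoint_near_polynomial\<close>), and \<open>\<parallel>C\<parallel>\<^bsup>3/2\<^esup>\<close> is at most a multiple of \<open>\<parallel>[A, C]\<parallel>\<close>
  (\<open>self_commutator_gradient_inequality\<close>). It follows that the curve has finite length
  (\<open>double_bracket_flow_converges\<close>).

  The limit is not zero, since \<open>q(B) = 0\<close> would otherwise force \<open>B\<close> at late times, and with it \<open>A\<^sub>0\<close>, to be nilpotent
  (\<open>double_bracket_flow_limit_zero_imp_nilpotent\<close>). The roots of \<open>q\<close> may be complex, which is why
  the gradient flow is studied for complex matrices, with real ones embedded entrywise.
\<close>

section \<open>Complex matrices with the Hermitian adjoint\<close>

definition adj :: "complex ^ 'n ^ 'n \<Rightarrow> complex ^ 'n ^ 'n" where
  "adj A = (\<chi> i j. cnj (A $ j $ i))"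

definition bracket :: "complex ^ 'n ^ 'n \<Rightarrow> complex ^ 'n ^ 'n \<Rightarrow> complex ^ 'n ^ 'n" where
  "bracket A B = A ** B - B ** A"

lemma adj_adj [simp]: "adj (adj A) = A"
  by (simp add: adj_def vec_eq_iff)

lemma adj_add: "adj (A + B) = adj A + adj B"
  and adj_diff: "adj (A - B) = adj A - adj B"
  and adj_zero [simp]: "adj 0 = 0"
  by (simp_all add: adj_def vec_eq_iff)

lemma adj_mult: "adj (A ** B) = adj B ** adj A"
  by (simp add: adj_def vec_eq_iff matrix_matrix_mult_def mult.commute)

lemma adj_mat [simp]: "adj (mat z) = mat (cnj z)"
  by (simp add: adj_def vec_eq_iff mat_def)

lemma adj_sum: "adj (\<Sum>k\<in>I. f k) = (\<Sum>k\<in>I. adj (f k))"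
  by (induction I rule: infinite_finite_induct) (simp_all add: adj_add)

lemma inner_adj: "adj A \<bullet> adj B = A \<bullet> B"
  unfolding inner_vec_def adj_def by (simp add: inner_complex_def, rule sum.swap)

lemma norm_adj [simp]: "norm (adj A) = norm A"
  by (simp add: norm_eq_sqrt_inner inner_adj)

text \<open>
  The inner product of the type is \<open>Re (tr (A ** adj B))\<close>, so multiplication by \<open>Y\<close> has the adjoint
  operator given by multiplication by \<open>adj Y\<close>, on either side.
\<close>

lemma inner_cmult_left:
  fixes H Y C :: "complex ^ 'n ^ 'n"
  shows "(Y ** H) \<bullet> C = H \<bullet> (adj Y ** C)"
proof -
  have e: "(y * h) \<bullet> c = h \<bullet> (cnj y * c)" for y h c :: complex
    by (simp add: inner_complex_def algebra_simps)
  have "(Y ** H) \<bullet> C = (\<Sum>i\<in>UNIV. \<Sum>j\<in>UNIV. \<Sum>k\<in>UNIV. H$k$j \<bullet> (cnj (Y$i$k) * C$i$j))"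
    by (simp add: inner_vec_def matrix_matrix_mult_def inner_sum_left e)
  also have "\<dots> = (\<Sum>i\<in>UNIV. \<Sum>k\<in>UNIV. \<Sum>j\<in>UNIV. H$k$j \<bullet> (cnj (Y$i$k) * C$i$j))"
    by (intro sum.cong refl sum.swap)
  also have "\<dots> = (\<Sum>k\<in>UNIV. \<Sum>i\<in>UNIV. \<Sum>j\<in>UNIV. H$k$j \<bullet> (cnj (Y$i$k) * C$i$j))"
    by (rule sum.swap)
  also have "\<dots> = (\<Sum>k\<in>UNIV. \<Sum>j\<in>UNIV. \<Sum>i\<in>UNIV. H$k$j \<bullet> (cnj (Y$i$k) * C$i$j))"
    by (intro sum.cong refl sum.swap)
  also have "\<dots> = H \<bullet> (adj Y ** C)"
    by (simp add: inner_vec_def matrix_matrix_mult_def inner_sum_right adj_def)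
  finally show ?thesis .
qed

lemma inner_cmult_right:
  fixes H Y C :: "complex ^ 'n ^ 'n"
  shows "(H ** Y) \<bullet> C = H \<bullet> (C ** adj Y)"
proof -
  have "(H ** Y) \<bullet> C = (adj Y ** adj H) \<bullet> adj C"
    by (simp add: adj_mult[symmetric] inner_adj)
  also have "\<dots> = adj H \<bullet> adj (C ** adj Y)"
    by (simp add: inner_cmult_left adj_mult)
  finally show ?thesis
    by (simp add: inner_adj)
qed

lemma norm_cmult_le:
  fixes X Y :: "complex ^ 'n ^ 'n"
  shows "norm (X ** Y) \<le> norm X * norm Y"
proof -
  define c where "c k = sqrt (\<Sum>i\<in>UNIV. (norm (Y $ i $ k))\<^sup>2)" for k
  have nsq: "(norm Z)\<^sup>2 = (\<Sum>i\<in>UNIV. \<Sum>j\<in>UNIV. (norm (Z $ i $ j))\<^sup>2)" for Z :: "complex ^ 'n ^ 'n"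
    by (simp add: norm_vec_def L2_set_def sum_nonneg)
  have entry: "norm ((X ** Y) $ i $ j) \<le> norm (X $ i) * c j" for i j
  proof -
    have "norm ((X ** Y) $ i $ j) \<le> (\<Sum>k\<in>UNIV. \<bar>norm (X $ i $ k)\<bar> * \<bar>norm (Y $ k $ j)\<bar>)"
      by (simp add: matrix_matrix_mult_def) (rule sum_norm_le, simp add: norm_mult)
    also have "\<dots> \<le> norm (X $ i) * c j"
      unfolding norm_vec_def c_def L2_set_def[symmetric] by (rule L2_set_mult_ineq)
    finally show ?thesis .
  qed
  have "(norm (X ** Y))\<^sup>2 \<le> (\<Sum>i\<in>UNIV. \<Sum>j\<in>UNIV. (norm (X $ i) * c j)\<^sup>2)"
    unfolding nsq by (intro sum_mono power_mono entry) simp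
  also have "\<dots> = (\<Sum>i\<in>UNIV. (norm (X $ i))\<^sup>2) * (\<Sum>j\<in>UNIV. (c j)\<^sup>2)"
    by (simp add: power_mult_distrib sum_product)
  also have "(\<Sum>j\<in>UNIV. (c j)\<^sup>2) = (norm Y)\<^sup>2"
    unfolding nsq c_def by (simp add: sum_nonneg) (rule sum.swap)
  also have "(\<Sum>i\<in>UNIV. (norm (X $ i))\<^sup>2) = (norm X)\<^sup>2"
    by (simp add: norm_vec_def L2_set_def sum_nonneg)
  finally show ?thesis
    by (simp add: power_mult_distrib[symmetric] power2_le_iff_abs_le)
qed

lemma cmult_add_rdistrib: "(A + B) ** C = A ** C + B ** C"
  for A B C :: "complex ^ 'n ^ 'n"
  by (simp add: vec_eq_iff matrix_matrix_mult_def distrib_right sum.distrib)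

lemma bounded_bilinear_cmult:
  "bounded_bilinear ((**) :: complex ^ 'n ^ 'n \<Rightarrow> _ \<Rightarrow> complex ^ 'n ^ 'n)"
proof
  show "\<exists>K. \<forall>(A :: complex ^ 'n ^ 'n) (B :: complex ^ 'n ^ 'n). norm (A ** B) \<le> norm A * norm B * K"
    by (rule exI[of _ 1]) (simp add: norm_cmult_le)
  show "(r *\<^sub>R A) ** B = r *\<^sub>R (A ** B)" "A ** (r *\<^sub>R B) = r *\<^sub>R (A ** B)"
    for r and A B :: "complex ^ 'n ^ 'n"
    by (simp_all add: vec_eq_iff matrix_matrix_mult_def scaleR_sum_right)
qed (simp_all add: cmult_add_rdistrib matrix_add_ldistrib)

interpretation cmult: bounded_bilinear "(**) :: complex ^ 'n ^ 'n \<Rightarrow> _ \<Rightarrow> complex ^ 'n ^ 'n"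
  by (rule bounded_bilinear_cmult)

lemmas cmult_distribs = cmult.add_left cmult.add_right cmult.diff_left cmult.diff_right
  cmult.minus_left cmult.minus_right matrix_mul_assoc

lemma mat_mult_commute: "A ** mat z = mat z ** A" for A :: "complex ^ 'n ^ 'n"
  by (simp add: vec_eq_iff matrix_matrix_mult_def mat_def mult.commute
      if_distrib[of "\<lambda>x. _ * x"] if_distrib[of "\<lambda>x. x * _"] sum.delta sum.delta' cong: if_cong)

lemma mat_add: "mat (a + b) = (mat a + mat b :: complex ^ 'n ^ 'n)"
  and mat_minus: "mat (- b) = (- mat b :: complex ^ 'n ^ 'n)"
  and mat_zero: "mat 0 = (0 :: complex ^ 'n ^ 'n)"
  by (simp_all add: vec_eq_iff mat_def)

lemma mat_mult: "mat (a * b) = (mat a ** mat b :: complex ^ 'n ^ 'n)"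
  by (simp add: vec_eq_iff matrix_matrix_mult_def mat_def
      if_distrib[of "\<lambda>x. _ * x"] if_distrib[of "\<lambda>x. x * _"] sum.delta sum.delta' cong: if_cong)

lemma norm_mat_mult: "norm (mat z ** A) = norm z * norm A" for A :: "complex ^ 'n ^ 'n"
proof -
  have "(mat z ** A) $ i $ j = z * A $ i $ j" for i j
    by (simp add: matrix_matrix_mult_def mat_def
      if_distrib[of "\<lambda>x. x * _"] sum.delta sum.delta' cong: if_cong)
  then show ?thesis
    by (simp add: norm_vec_def L2_set_def norm_mult power_mult_distrib sum_distrib_left[symmetric]
        real_sqrt_mult sum_nonneg)
qed

section \<open>Orthogonal projections onto kernels\<close>

text \<open>
  For a right ideal \<open>S\<close> of matrices, the component \<open>P\<close> of the identity in \<open>S\<close> is a Hermitian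
  projection that fixes every member \<open>X\<close> of \<open>S\<close>: orthogonality of \<open>1 - P\<close> to
  \<open>X ** Y\<close>, for all \<open>Y\<close>, says \<open>adj X ** (1 - P) = 0\<close>. With \<open>S\<close> the annihilator of \<open>M\<close> this gives
  the orthogonal projection onto the kernel of \<open>M\<close> without any reference to vectors.
\<close>

lemma kernel_projection_exists:
  fixes M :: "complex ^ 'n ^ 'n"
  obtains P where "adj P = P" "P ** P = P" "M ** P = 0" "\<And>X :: complex ^ 'n ^ 'n. M ** X = 0 \<Longrightarrow> P ** X = X"
proof -
  define S where "S = {X :: complex ^ 'n ^ 'n. M ** X = 0}"
  have sub: "subspace S"
    unfolding S_def by (auto simp: subspace_def cmult.add_right cmult.scaleR_right)
  obtain P Q where P: "P \<in> span S" and Q: "\<And>w. w \<in> span S \<Longrightarrow> orthogonal Q w"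
    and PQ: "mat 1 = P + Q"
    using orthogonal_subspace_decomp_exists[of S "mat 1"] by metis
  have PS: "M ** P = 0"
    using P sub by (simp add: span_eq_iff[THEN iffD2] S_def)
  have ann: "adj X ** Q = 0" if "M ** X = 0" for X :: "complex ^ 'n ^ 'n"
  proof -
    have "X ** Y \<in> span S" for Y
      using that by (intro span_base) (simp add: S_def matrix_mul_assoc)
    then have "Q \<bullet> (X ** (adj X ** Q)) = 0"
      using Q by (simp add: orthogonal_def)
    then have "(adj X ** Q) \<bullet> (adj X ** Q) = 0"
      by (metis inner_cmult_left inner_commute)
    then show ?thesis by simp
  qed
  have Qeq: "Q = mat 1 - P" using PQ by simp
  have aP: "adj P = adj P ** P"
    using ann[OF PS] by (simp add: Qeq cmult_distribs)
  have sa: "adj P = P"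
    by (metis aP adj_adj adj_mult)
  have fix1: "P ** X = X" if "M ** X = 0" for X :: "complex ^ 'n ^ 'n"
  proof -
    have "adj X ** P = adj X"
      using ann[OF that] by (simp add: Qeq cmult_distribs)
    from arg_cong[OF this, of adj] show ?thesis
      by (simp add: adj_mult sa)
  qed
  show ?thesis
    using that[OF sa fix1[OF PS] PS fix1] .
qed

lemma hermitian_projection_pythagoras:
  fixes P X :: "complex ^ 'n ^ 'n"
  assumes "adj P = P" "P ** P = P"
  shows "(norm X)\<^sup>2 = (norm (X ** P))\<^sup>2 + (norm (X ** (mat 1 - P)))\<^sup>2"
proof -
  have "(mat 1 - P) ** P = 0"
    using assms by (simp add: cmult_distribs)
  then have "(X ** P) \<bullet> (X ** (mat 1 - P)) = 0"
    using assms by (simp add: inner_cmult_right matrix_mul_assoc[symmetric])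
  moreover have "X = X ** P + X ** (mat 1 - P)"
    by (simp add: cmult_distribs)
  ultimately show ?thesis
    using norm_add_Pythagorean[of "X ** P" "X ** (mat 1 - P)"] by (simp add: orthogonal_def)
qed

text \<open>
  Henrici's argument for one invariant subspace. Pairing the self-commutator with the projection
  \<open>P\<close> gives \<open>\<parallel>P A\<parallel>\<^sup>2 - \<parallel>A P\<parallel>\<^sup>2\<close>; invariance turns \<open>A P\<close> into \<open>P A P\<close>, and by Pythagoras only the
  block off the diagonal survives.
\<close>

lemma offdiagonal_block_le:
  fixes P A :: "complex ^ 'n ^ 'n"
  assumes "adj P = P" "P ** P = P" "P ** A ** P = A ** P"
  shows "(norm (P ** A ** (mat 1 - P)))\<^sup>2 \<le> norm (bracket A (adj A)) * norm P"
proof -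
  have 1: "(A ** adj A) \<bullet> P = (norm (P ** A))\<^sup>2"
  proof -
    have "(A ** adj A) \<bullet> P = A \<bullet> (adj P ** (P ** A))"
      using assms by (simp add: inner_cmult_right matrix_mul_assoc)
    also have "\<dots> = (norm (P ** A))\<^sup>2"
      by (simp add: inner_cmult_left[symmetric] power2_norm_eq_inner)
    finally show ?thesis .
  qed
  have 2: "(adj A ** A) \<bullet> P = (norm (A ** P))\<^sup>2"
  proof -
    have "(adj A ** A) \<bullet> P = A \<bullet> (A ** P)"
      by (simp add: inner_cmult_left)
    also have "\<dots> = A \<bullet> (A ** P ** adj P)"
      using assms by (simp add: matrix_mul_assoc[symmetric])
    also have "\<dots> = (norm (A ** P))\<^sup>2"
      by (simp add: inner_cmult_right power2_norm_eq_inner)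
    finally show ?thesis .
  qed
  have "(norm (P ** A ** (mat 1 - P)))\<^sup>2 = bracket A (adj A) \<bullet> P"
    using hermitian_projection_pythagoras[OF assms(1,2), of "P ** A"] assms(3)
    by (simp add: bracket_def inner_diff_left 1 2)
  also have "\<dots> \<le> norm (bracket A (adj A)) * norm P"
    by (rule norm_cauchy_schwarz)
  finally show ?thesis .
qed

section \<open>Polynomials in a complex matrix\<close>

text \<open>
  Horner's scheme: \<open>poly\<close> itself does not apply, because the ring multiplication of the type is
  entrywise.
\<close>

definition peval :: "complex poly \<Rightarrow> complex ^ 'n ^ 'n \<Rightarrow> complex ^ 'n ^ 'n" where
  "peval p A = fold_coeffs (\<lambda>a B. mat a + A ** B) p 0"

lemma peval_0 [simp]: "peval 0 A = 0"
  by (simp add: peval_def)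

lemma peval_pCons [simp]: "peval (pCons a p) A = mat a + A ** peval p A"
  by (cases "p = 0 \<and> a = 0") (auto simp: peval_def mat_zero)

lemma peval_1 [simp]: "peval 1 A = mat 1"
  by (simp add: one_pCons)

lemma peval_add: "peval (p + q) A = peval p A + peval q A"
  by (induction p q rule: poly_induct2) (simp_all add: mat_add cmult_distribs)

lemma peval_smult: "peval (smult a p) A = mat a ** peval p A"
proof (induction p)
  case (pCons b p)
  have "A ** (mat a ** peval p A) = mat a ** (A ** peval p A)"
    by (metis mat_mult_commute matrix_mul_assoc)
  then show ?case
    by (simp add: pCons.IH mat_mult matrix_add_ldistrib)
qed simp

lemma peval_minus: "peval (- q) A = - peval q A"
  using peval_smult[of "- 1" q A] by (simp add: mat_minus cmult.minus_left)

lemma peval_diff: "peval (p - q) A = peval p A - peval q A"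
  using peval_add[of p "- q" A] by (simp add: peval_minus)

lemma peval_mult: "peval (p * q) A = peval p A ** peval q A"
  by (induction p)
    (simp_all add: peval_add peval_smult cmult_distribs mat_zero)

lemma peval_commute: "peval p A ** peval q A = peval q A ** peval p A"
  by (simp add: peval_mult[symmetric] mult.commute)

lemma peval_linear [simp]: "peval [:- z, 1:] A = A - mat z"
  by (simp add: mat_minus)

lemma peval_self_commute: "peval p A ** A = A ** peval p A"
  using peval_commute[of p A "[:0, 1:]"] by (simp add: mat_zero)

lemma peval_sum: "peval (\<Sum>i\<in>I. f i) A = (\<Sum>i\<in>I. peval (f i) A)"
  by (induction I rule: infinite_finite_induct) (simp_all add: peval_add)

text \<open>
  More powers of \<open>A\<close> than the dimension of the matrix space are linearly dependent, unless two of them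
  coincide; both cases give a polynomial.
\<close>

lemma annihilating_poly_exists:
  fixes A :: "complex ^ 'n ^ 'n"
  obtains q where "q \<noteq> 0" "peval q A = 0"
proof -
  define N where "N = DIM(complex ^ 'n ^ 'n)"
  define pow where "pow i = peval (monom 1 i) A" for i
  show ?thesis
  proof (cases "inj_on pow {..N}")
    case False
    then obtain i j where "i \<noteq> j" "pow i = pow j"
      by (auto simp: inj_on_def)
    moreover from this have "monom (1::complex) i - monom 1 j \<noteq> 0"
      by (auto dest!: arg_cong[of _ _ "\<lambda>p. coeff p i"])
    ultimately show ?thesis
      using that[of "monom 1 i - monom 1 j"] by (simp add: peval_diff pow_def)
  next
    case True
    then have "card (pow ` {..N}) > DIM(complex ^ 'n ^ 'n)"
      by (simp add: card_image N_def)
    then have "dependent (pow ` {..N})"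
      using independent_bound[of "pow ` {..N}"] by auto
    then obtain u where u: "\<exists>v\<in>pow ` {..N}. u v \<noteq> 0" "(\<Sum>v\<in>pow ` {..N}. u v *\<^sub>R v) = 0"
      by (auto simp: dependent_finite)
    define q where "q = (\<Sum>i\<le>N. monom (complex_of_real (u (pow i))) i)"
    have mon: "peval (monom (complex_of_real r) i) A = r *\<^sub>R pow i" for r i
    proof -
      have "mat (complex_of_real r) = (r *\<^sub>R mat 1 :: complex ^ 'n ^ 'n)"
        by (simp add: vec_eq_iff mat_def of_real_def)
      then show ?thesis
        using peval_smult[of "complex_of_real r" "monom 1 i" A]
        by (simp add: smult_monom pow_def cmult.scaleR_left)
    qed
    have "peval q A = (\<Sum>i\<le>N. u (pow i) *\<^sub>R pow i)"
      by (simp add: q_def peval_sum mon)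
    also have "\<dots> = 0"
      using u(2) by (simp add: sum.reindex[OF True])
    finally have "peval q A = 0" .
    moreover obtain i where "i \<le> N" "u (pow i) \<noteq> 0"
      using u(1) by auto
    then have "coeff q i \<noteq> 0"
      by (simp add: q_def coeff_sum)
    then have "q \<noteq> 0" by auto
    ultimately show ?thesis using that by blast
  qed
qed

lemma split_annihilating_poly_exists:
  fixes A :: "complex ^ 'n ^ 'n"
  obtains z :: "nat \<Rightarrow> complex" and m where "peval (\<Prod>i<m. [:- z i, 1:]) A = 0"
proof -
  obtain q where q: "q \<noteq> 0" "peval q A = 0"
    by (rule annihilating_poly_exists)
  obtain R where R: "q = smult (lead_coeff q) (\<Prod>x\<in>#R. [:- x, 1:])"
    using alg_closed_imp_factorization[OF q(1)] by blast
  obtain xs where xs: "mset xs = R"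
    using ex_mset by blast
  have "(\<Prod>x\<in>#R. [:- x, 1:]) = smult (inverse (lead_coeff q)) q"
    using q(1) by (subst (2) R) simp
  moreover have "(\<Prod>x\<in>#R. [:- x, 1:]) = (\<Prod>i<length xs. [:- (xs ! i), 1:])"
    unfolding xs[symmetric]
    by (simp add: mset_map[symmetric] prod_mset_prod_list prod.list_conv_set_nth atLeast0LessThan
        del: mset_map)
  ultimately show ?thesis
    using that[where z = "\<lambda>i. xs ! i" and m = "length xs"] q(2) by (simp add: peval_smult)
qed

lemma interpolating_poly_exists:
  fixes f :: "'a :: field \<Rightarrow> 'a"
  assumes "finite S"
  obtains p where "\<And>z. z \<in> S \<Longrightarrow> poly p z = f z"
proof -
  have "\<exists>p. \<forall>z\<in>S. poly p z = f z"
    using assms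
  proof (induction S)
    case (insert x S)
    then obtain p where p: "\<forall>z\<in>S. poly p z = f z" by blast
    define w where "w = (\<Prod>y\<in>S. [:- y, 1:])"
    have "poly w x \<noteq> 0" "\<forall>z\<in>S. poly w z = 0"
      using insert by (auto simp: w_def poly_prod)
    then show ?case
      using p by (intro exI[of _ "p + smult ((f x - poly p x) / poly w x) w"]) auto
  qed simp
  then show ?thesis using that by blast
qed

lemma peval_minus_value:
  obtains r where "\<And>A. peval p A - mat (poly p z) = peval r A ** (A - mat z)"
proof -
  have "poly (p - [:poly p z:]) z = 0" by simp
  then obtain r where r: "p - [:poly p z:] = [:- z, 1:] * r"
    unfolding poly_eq_0_iff_dvd by (elim dvdE)
  have "peval p A - mat (poly p z) = peval r A ** (A - mat z)" for A
    using arg_cong[OF r, of "\<lambda>p. peval p A"]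
    by (simp only: peval_diff peval_mult peval_commute[of "[:- z, 1:]"]) (simp add: mat_minus)
  then show ?thesis using that by blast
qed

lemma peval_bounded:
  obtains K where "K \<ge> 0" "\<And>A :: complex ^ 'n ^ 'n. norm A \<le> R \<Longrightarrow> norm (peval p A) \<le> K"
proof -
  have "\<exists>K\<ge>0. \<forall>A :: complex ^ 'n ^ 'n. norm A \<le> R \<longrightarrow> norm (peval p A) \<le> K"
  proof (induction p)
    case 0
    then show ?case by (auto intro: exI[of _ 0])
  next
    case (pCons a p)
    then obtain K where K: "K \<ge> 0" "\<And>A :: complex ^ 'n ^ 'n. norm A \<le> R \<Longrightarrow> norm (peval p A) \<le> K"
      by blast
    let ?K = "norm (mat a :: complex ^ 'n ^ 'n) + \<bar>R\<bar> * K"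
    have "norm (peval (pCons a p) A) \<le> ?K" if "norm A \<le> R" for A :: "complex ^ 'n ^ 'n"
    proof -
      have "norm (A ** peval p A) \<le> \<bar>R\<bar> * K"
        using norm_cmult_le[of A "peval p A"] mult_mono[of "norm A" "\<bar>R\<bar>" "norm (peval p A)" K]
          that K by fastforce
      then show ?thesis
        using norm_triangle_le by (metis add_left_mono peval_pCons)
    qed
    then show ?case
      using K(1) by (intro exI[of _ ?K]) auto
  qed
  then show ?thesis using that by blast
qed

section \<open>Departure from normality\<close>

text \<open>
  The kernels of the partial products \<open>M k = (A - z\<^sub>0) \<dots> (A - z\<^bsub>k-1\<^esub>)\<close> form a flag of invariant
  subspaces, and \<open>A - z\<^sub>k\<close> maps each member into the preceding one. With \<open>P k\<close> the orthogonal projections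
  and \<open>D k\<close> their differences, \<open>A\<close> thus equals \<open>\<Sum>k. z\<^sub>k D k\<close> plus
  the sum of the blocks \<open>N k = (A - z\<^sub>k) D k\<close>, which lie strictly above the diagonal and are controlled by Henrici's estimate. On \<open>D k\<close> both \<open>A\<^sup>*\<close> and \<open>p(A)\<close> act as the
  scalar \<open>cnj z\<^sub>k\<close>, up to errors linear in the blocks: for \<open>p(A)\<close> because \<open>x - z\<^sub>k\<close> divides \<open>p(x) - p(z\<^sub>k)\<close>.
  The constants depend only on \<open>R\<close> and the roots.
\<close>

lemma adjoint_near_polynomial:
  fixes z :: "nat \<Rightarrow> complex"
  obtains p K where "K \<ge> 0"
    "\<And>A :: complex ^ 'n ^ 'n. norm A \<le> R \<Longrightarrow> peval (\<Prod>i<m. [:- z i, 1:]) A = 0 \<Longrightarrow>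
       norm (adj A - peval p A) \<le> K * sqrt (norm (bracket A (adj A)))"
proof -
  obtain p where "\<And>w. w \<in> z ` {..<m} \<Longrightarrow> poly p w = cnj w"
    using interpolating_poly_exists[of "z ` {..<m}" cnj] by blast
  then have p: "poly p (z k) = cnj (z k)" if "k < m" for k
    using that by blast
  have "\<exists>r. \<forall>A :: complex ^ 'n ^ 'n. peval p A - mat (poly p (z k)) = peval r A ** (A - mat (z k))" for k
    using peval_minus_value[where 'a = 'n, of p "z k"] by metis
  then obtain r where r: "\<And>k (A :: complex ^ 'n ^ 'n).
      peval p A - mat (poly p (z k)) = peval (r k) A ** (A - mat (z k))"
    by metis
  have "\<exists>K\<ge>0. \<forall>A :: complex ^ 'n ^ 'n. norm A \<le> R \<longrightarrow> norm (peval (r k) A) \<le> K" for k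
    using peval_bounded by metis
  then obtain K where K0: "\<And>k. K k \<ge> 0"
    and K: "\<And>k (A :: complex ^ 'n ^ 'n). norm A \<le> R \<Longrightarrow> norm (peval (r k) A) \<le> K k"
    by metis
  define c where "c = norm (mat 1 :: complex ^ 'n ^ 'n)"
  have main: "norm (adj A - peval p A) \<le> (\<Sum>k<m. 1 + K k) * (sqrt c * c) * sqrt (norm (bracket A (adj A)))"
    if AR: "norm A \<le> R" and ann: "peval (\<Prod>i<m. [:- z i, 1:]) A = 0" for A :: "complex ^ 'n ^ 'n"
  proof -
    define M where "M k = peval (\<Prod>i<k. [:- z i, 1:]) A" for k
    have MA: "M k ** A = A ** M k" for k
      by (simp add: M_def peval_self_commute)
    have MSuc: "M (Suc k) = M k ** (A - mat (z k))" "M (Suc k) = (A - mat (z k)) ** M k" for k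
      using peval_commute[of "[:- z k, 1:]" A "\<Prod>i<k. [:- z i, 1:]"]
      by (simp_all add: M_def peval_mult del: peval_pCons mult_pCons_left mult_pCons_right)
    have "\<forall>k. \<exists>P. adj P = P \<and> P ** P = P \<and> M k ** P = 0 \<and> (\<forall>X :: complex ^ 'n ^ 'n. M k ** X = 0 \<longrightarrow> P ** X = X)"
      using kernel_projection_exists by metis
    then obtain P where sa: "\<And>k. adj (P k) = P k" and idem: "\<And>k. P k ** P k = P k"
      and MP: "\<And>k. M k ** P k = 0"
      and fixP: "\<And>k X :: complex ^ 'n ^ 'n. M k ** X = 0 \<Longrightarrow> P k ** X = X"
      by metis
    have P0: "P 0 = 0"
      using MP[of 0] by (simp add: M_def)
    have Pm: "P m = mat 1"
      using fixP[of m "mat 1"] ann by (simp add: M_def)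
    have nest1: "P (Suc k) ** P k = P k" for k
      by (rule fixP) (simp add: MSuc(2) matrix_mul_assoc[symmetric] MP)
    have nest2: "P k ** P (Suc k) = P k" for k
      by (metis nest1 adj_mult sa)
    have inv: "P k ** A ** P k = A ** P k" for k
    proof -
      have "M k ** (A ** P k) = 0"
        by (metis MA MP cmult.zero_right matrix_mul_assoc)
      from fixP[OF this] show ?thesis by (simp add: matrix_mul_assoc)
    qed
    have shift: "P k ** ((A - mat (z k)) ** P (Suc k)) = (A - mat (z k)) ** P (Suc k)" for k
      by (rule fixP) (simp add: MSuc(1)[symmetric] matrix_mul_assoc MP)
    define D where "D k = P (Suc k) - P k" for k
    define N where "N k = (A - mat (z k)) ** D k" for k
    have D1: "D k = P (Suc k) ** (mat 1 - P k)" and D2: "D k = (mat 1 - P k) ** P (Suc k)" for k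
      by (simp_all add: D_def cmult_distribs nest1 nest2)
    have PD: "P k ** D k = 0" for k
      by (simp add: D_def cmult_distribs nest2 idem)
    \<comment> \<open>The shift into the range of \<open>P k\<close> puts \<open>P k\<close> on the left. The range of \<open>D k\<close> is orthogonal to that of
      \<open>P k\<close>, which removes the scalar \<open>z k\<close> and puts \<open>mat 1 - P k\<close> on the right.\<close>
    have N_eq: "N k = P k ** A ** (mat 1 - P k) ** P (Suc k)" for k
    proof -
      have "N k = P k ** N k"
        using shift[of k] by (simp add: N_def D1 matrix_mul_assoc)
      also have "\<dots> = P k ** A ** D k - mat (z k) ** (P k ** D k)"
        unfolding N_def by (simp add: cmult_distribs mat_mult_commute[of "P k"])
      also have "\<dots> = P k ** A ** (mat 1 - P k) ** P (Suc k)"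
        by (simp add: PD) (simp add: D2 matrix_mul_assoc)
      finally show ?thesis .
    qed
    have normP: "norm (P k) \<le> c" for k
    proof -
      have "(norm (P k))\<^sup>2 \<le> c\<^sup>2"
        using hermitian_projection_pythagoras[OF sa idem, of "mat 1" k] by (simp add: c_def)
      then show ?thesis by (simp add: c_def power2_le_iff_abs_le)
    qed
    define \<delta> where "\<delta> = sqrt c * c * sqrt (norm (bracket A (adj A)))"
    have c0: "c \<ge> 0" by (simp add: c_def)
    have normN: "norm (N k) \<le> \<delta>" for k
    proof -
      have "(norm (P k ** A ** (mat 1 - P k)))\<^sup>2 \<le> norm (bracket A (adj A)) * c"
        using offdiagonal_block_le[OF sa idem inv, of k]
          mult_left_mono[OF normP[of k] norm_ge_zero, of "bracket A (adj A)"] by linarith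
      then have "norm (P k ** A ** (mat 1 - P k)) \<le> sqrt (norm (bracket A (adj A)) * c)"
        by (simp add: real_le_rsqrt)
      then have "norm (P k ** A ** (mat 1 - P k)) * norm (P (Suc k))
          \<le> sqrt (norm (bracket A (adj A)) * c) * c"
        using normP c0 by (intro mult_mono) auto
      then show ?thesis
        using norm_cmult_le[of "P k ** A ** (mat 1 - P k)" "P (Suc k)"]
        by (simp add: N_eq \<delta>_def real_sqrt_mult mult_ac)
    qed
    have sumD: "(\<Sum>k<m. D k) = mat 1"
      by (simp add: D_def sum_lessThan_telescope P0 Pm)
    have adjD: "adj (D k) = D k" for k
      by (simp add: D_def adj_diff sa)
    have "A = (\<Sum>k<m. A ** D k)"
      by (simp add: cmult.sum_right[symmetric] sumD)
    also have "\<dots> = (\<Sum>k<m. N k + mat (z k) ** D k)"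
      by (simp add: N_def cmult_distribs)
    finally have "adj A = adj (\<Sum>k<m. N k + mat (z k) ** D k)"
      by simp
    then have adjA: "adj A = (\<Sum>k<m. adj (N k) + mat (cnj (z k)) ** D k)"
      by (simp add: adj_sum adj_add adj_mult adjD mat_mult_commute)
    have "peval p A = (\<Sum>k<m. peval p A ** D k)"
      by (simp add: cmult.sum_right[symmetric] sumD)
    also have "\<dots> = (\<Sum>k<m. peval (r k) A ** N k + mat (cnj (z k)) ** D k)"
    proof (rule sum.cong[OF refl])
      fix k assume "k \<in> {..<m}"
      then have "peval p A = peval (r k) A ** (A - mat (z k)) + mat (cnj (z k))"
        using r[of A k] p[of k] by (simp add: algebra_simps)
      then show "peval p A ** D k = peval (r k) A ** N k + mat (cnj (z k)) ** D k"
        by (simp add: N_def cmult_add_rdistrib matrix_mul_assoc)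
    qed
    finally have "adj A - peval p A = (\<Sum>k<m. adj (N k) - peval (r k) A ** N k)"
      by (simp add: adjA sum_subtractf[symmetric])
    also have "norm \<dots> \<le> (\<Sum>k<m. (1 + K k) * \<delta>)"
    proof (rule sum_norm_le)
      fix k
      have "norm (peval (r k) A ** N k) \<le> K k * \<delta>"
        using norm_cmult_le[of "peval (r k) A" "N k"]
          mult_mono[OF K[OF AR] normN K0 norm_ge_zero, of k k] by linarith
      then show "norm (adj (N k) - peval (r k) A ** N k) \<le> (1 + K k) * \<delta>"
        using norm_triangle_ineq4[of "adj (N k)" "peval (r k) A ** N k"] normN[of k]
        by (simp add: algebra_simps)
    qed
    finally show ?thesis
      by (simp add: \<delta>_def sum_distrib_right[symmetric] mult.assoc)
  qed
  show ?thesis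
    by (rule that[of "(\<Sum>k<m. 1 + K k) * (sqrt c * c)" p])
      (use main in \<open>auto intro!: mult_nonneg_nonneg sum_nonneg add_nonneg_nonneg K0 simp: c_def\<close>)
qed

text \<open>
  This is Euler's identity for the quartic functional \<open>\<parallel>[A, A\<^sup>*]\<parallel>\<^sup>2\<close>, whose gradient is \<open>- 4 [A, [A, A\<^sup>*]]\<close>.
\<close>

lemma inner_gradient_self:
  fixes A :: "complex ^ 'n ^ 'n"
  shows "bracket A (bracket A (adj A)) \<bullet> A = - (norm (bracket A (adj A)))\<^sup>2"
proof -
  define C where "C = bracket A (adj A)"
  have "bracket A C \<bullet> A = C \<bullet> (adj A ** A) - C \<bullet> (A ** adj A)"
    by (simp add: bracket_def inner_diff_left inner_cmult_left[of A C] inner_cmult_right[of C A])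
  also have "\<dots> = - (C \<bullet> C)"
    unfolding inner_diff_right[symmetric] inner_minus_right[symmetric]
    by (simp add: C_def bracket_def)
  finally show ?thesis
    by (simp add: C_def power2_norm_eq_inner)
qed

text \<open>
  The gradient \<open>G\<close> is orthogonal to \<open>adj D\<close> for every \<open>D\<close> that commutes with \<open>A\<close>, so the identity
  \<open>\<parallel>C\<parallel>\<^sup>2 = - \<langle>G, A\<rangle>\<close> remains true with \<open>A - adj D\<close> in place of \<open>A\<close>. For \<open>D\<close> the polynomial that is
  near \<open>adj A\<close>, the second factor in the Cauchy-Schwarz inequality is of size \<open>\<parallel>C\<parallel>\<^bsup>1/2\<^esup>\<close>.
\<close>

lemma self_commutator_gradient_inequality:
  fixes z :: "nat \<Rightarrow> complex"
  obtains K where "K > 0"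
    "\<And>A :: complex ^ 'n ^ 'n. norm A \<le> R \<Longrightarrow> peval (\<Prod>i<m. [:- z i, 1:]) A = 0 \<Longrightarrow>
       norm (bracket A (adj A)) * sqrt (norm (bracket A (adj A)))
         \<le> K * norm (bracket A (bracket A (adj A)))"
proof -
  obtain K p where K0: "K \<ge> 0" and K: "\<And>A :: complex ^ 'n ^ 'n. norm A \<le> R \<Longrightarrow>
      peval (\<Prod>i<m. [:- z i, 1:]) A = 0 \<Longrightarrow>
      norm (adj A - peval p A) \<le> K * sqrt (norm (bracket A (adj A)))"
    by (rule adjoint_near_polynomial[where R = R and m = m and z = z]) blast
  have "norm (bracket A (adj A)) * sqrt (norm (bracket A (adj A)))
         \<le> (K + 1) * norm (bracket A (bracket A (adj A)))"
    if "norm A \<le> R" "peval (\<Prod>i<m. [:- z i, 1:]) A = 0" for A :: "complex ^ 'n ^ 'n"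
  proof -
    define C where "C = bracket A (adj A)"
    define G where "G = bracket A C"
    define D where "D = peval p A"
    have "adj A ** adj D = adj D ** adj A"
      by (simp add: adj_mult[symmetric] D_def peval_self_commute)
    then have "G \<bullet> adj D = 0"
      by (simp add: G_def bracket_def[of A C] inner_diff_left inner_cmult_left[of A C]
          inner_cmult_right[of C A])
    then have "(norm C)\<^sup>2 = - (G \<bullet> (A - adj D))"
      using inner_gradient_self[of A] by (simp add: G_def C_def inner_diff_right)
    also have "\<dots> \<le> norm G * norm (A - adj D)"
      using Cauchy_Schwarz_ineq2[of G "A - adj D"] by linarith
    also have "norm (A - adj D) = norm (adj A - D)"
      by (metis adj_adj adj_diff norm_adj)
    also have "norm G * norm (adj A - D) \<le> norm G * (K * sqrt (norm C))"
      using K[OF that] by (intro mult_left_mono) (auto simp: C_def D_def)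
    finally have *: "norm C * norm C \<le> (K * norm G) * sqrt (norm C)"
      by (simp add: power2_eq_square mult_ac)
    have "norm C * sqrt (norm C) \<le> K * norm G"
    proof (cases "norm C = 0")
      case False
      then have s: "sqrt (norm C) > 0" by simp
      have "(norm C * sqrt (norm C)) * sqrt (norm C) \<le> (K * norm G) * sqrt (norm C)"
        using * by (simp add: mult.assoc)
      then show ?thesis
        using s mult_right_le_imp_le by blast
    qed (use K0 in auto)
    also have "\<dots> \<le> (K + 1) * norm G"
      by (simp add: algebra_simps)
    finally show ?thesis by (simp add: C_def G_def)
  qed
  then show ?thesis
    using that[of "K + 1"] K0 by auto
qed

section \<open>Monotonicity, linear differential inequalities and limits\<close>

lemma nonincreasing_of_nonpos_derivative:
  fixes h :: "real \<Rightarrow> real"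
  assumes "a \<le> b"
    and der: "\<And>t. t \<in> {a..b} \<Longrightarrow> (h has_real_derivative h' t) (at t within {a..b})"
    and neg: "\<And>t. t \<in> {a..b} \<Longrightarrow> h' t \<le> 0"
  shows "h b \<le> h a"
proof (rule DERIV_nonpos_imp_decreasing_open[OF assms(1)])
  fix x assume x: "a < x" "x < b"
  then have "(h has_real_derivative h' x) (at x)"
    using der[of x] by (simp add: at_within_Icc_at)
  then show "\<exists>y. DERIV h x :> y \<and> y \<le> 0"
    using neg[of x] x by auto
next
  show "continuous_on {a..b} h"
    using der DERIV_continuous continuous_on_eq_continuous_within by blast
qed

lemma has_real_derivative_inner_self:
  assumes "(Y has_vector_derivative Y') (at t within S)"
  shows "((\<lambda>t. Y t \<bullet> Y t) has_real_derivative 2 * (Y' \<bullet> Y t)) (at t within S)"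
  using bounded_bilinear.has_vector_derivative[OF bounded_bilinear_inner assms assms]
  by (simp add: has_real_derivative_iff_has_vector_derivative inner_commute)

text \<open>
  Uniqueness in both time directions: \<open>\<parallel>Y\<parallel>\<^sup>2 e\<^bsup>-2Kt\<^esup>\<close> is nonincreasing, which carries a zero forwards, and
  \<open>\<parallel>Y\<parallel>\<^sup>2 e\<^bsup>2Kt\<^esup>\<close> is nondecreasing, which carries it backwards.
\<close>

lemma vanishing_of_linear_bound:
  fixes Y :: "real \<Rightarrow> 'a :: real_inner"
  assumes der: "\<And>t. t \<in> {a..b} \<Longrightarrow> (Y has_vector_derivative Y' t) (at t within {a..b})"
    and bound: "\<And>t. t \<in> {a..b} \<Longrightarrow> norm (Y' t) \<le> K * norm (Y t)"
    and s: "s \<in> {a..b}" "Y s = 0" and t: "t \<in> {a..b}"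
  shows "Y t = 0"
proof -
  define h where "h \<sigma> x = (Y x \<bullet> Y x) * exp (\<sigma> * x)" for \<sigma> x
  have dh: "(h \<sigma> has_real_derivative (2 * (Y' x \<bullet> Y x) + \<sigma> * (Y x \<bullet> Y x)) * exp (\<sigma> * x))
      (at x within {c..d})"
    if "x \<in> {c..d}" "{c..d} \<subseteq> {a..b}" for \<sigma> x c d
    unfolding h_def
    by (rule derivative_eq_intros has_real_derivative_inner_self
        has_vector_derivative_within_subset[OF der] refl | use that in force)+
      (simp add: algebra_simps)
  have inner_le: "\<bar>Y' x \<bullet> Y x\<bar> \<le> K * (Y x \<bullet> Y x)" if "x \<in> {a..b}" for x
  proof -
    have "\<bar>Y' x \<bullet> Y x\<bar> \<le> norm (Y' x) * norm (Y x)"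
      by (rule Cauchy_Schwarz_ineq2)
    also have "\<dots> \<le> K * norm (Y x) * norm (Y x)"
      using bound[OF that] by (intro mult_right_mono) auto
    finally show ?thesis
      by (simp add: power2_norm_eq_inner[symmetric] power2_eq_square mult.assoc)
  qed
  have hs: "h \<sigma> s = 0" for \<sigma>
    by (simp add: h_def s)
  have "\<exists>\<sigma>. h \<sigma> t \<le> 0"
  proof (cases "s \<le> t")
    case True
    have "h (- 2 * K) t \<le> h (- 2 * K) s"
    proof (rule nonincreasing_of_nonpos_derivative[OF True dh])
      fix x assume x: "x \<in> {s..t}"
      then have "2 * (Y' x \<bullet> Y x) + - 2 * K * (Y x \<bullet> Y x) \<le> 0"
        using inner_le[of x] s t by auto
      then show "(2 * (Y' x \<bullet> Y x) + - 2 * K * (Y x \<bullet> Y x)) * exp (- 2 * K * x) \<le> 0"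
        by (simp add: mult_nonpos_nonneg)
    qed (use s t in auto)
    then show ?thesis by (auto simp: hs)
  next
    case False
    then have le: "t \<le> s" by simp
    have "- h (2 * K) s \<le> - h (2 * K) t"
    proof (rule nonincreasing_of_nonpos_derivative[OF le DERIV_minus[OF dh]])
      fix x assume x: "x \<in> {t..s}"
      then have "2 * (Y' x \<bullet> Y x) + 2 * K * (Y x \<bullet> Y x) \<ge> 0"
        using inner_le[of x] s t by auto
      then show "- ((2 * (Y' x \<bullet> Y x) + 2 * K * (Y x \<bullet> Y x)) * exp (2 * K * x)) \<le> 0"
        by simp
    qed (use s t in auto)
    then show ?thesis by (auto simp: hs)
  qed
  then have "Y t \<bullet> Y t \<le> 0"
    by (auto simp: h_def mult_le_0_iff dest: order_trans)
  then show ?thesis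
    using inner_ge_zero[of "Y t"] by (simp add: antisym)
qed

lemma norm_diff_le_of_speed_le:
  fixes f :: "real \<Rightarrow> 'a :: real_normed_vector"
  assumes "s \<le> t"
    and f: "\<And>x. x \<in> {s..t} \<Longrightarrow> (f has_vector_derivative f' x) (at x within {s..t})"
    and g: "\<And>x. x \<in> {s..t} \<Longrightarrow> (g has_real_derivative g' x) (at x within {s..t})"
    and le: "\<And>x. x \<in> {s..t} \<Longrightarrow> norm (f' x) \<le> g' x"
  shows "norm (f t - f s) \<le> g t - g s"
proof (cases "s = t")
  case False
  show ?thesis
  proof (rule differentiable_bound_general[where f' = f' and \<phi>' = g'])
    show "continuous_on {s..t} f"
      using f has_vector_derivative_continuous continuous_on_eq_continuous_within by blast
    show "continuous_on {s..t} g"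
      using g DERIV_continuous continuous_on_eq_continuous_within by blast
    fix x assume x: "s < x" "x < t"
    show "(f has_vector_derivative f' x) (at x)"
      using f[of x] x by (simp add: at_within_Icc_at)
    show "(g has_vector_derivative g' x) (at x)"
      using g[of x] x
      by (simp add: at_within_Icc_at has_real_derivative_iff_has_vector_derivative)
    show "norm (f' x) \<le> g' x" using le x by simp
  qed (use False \<open>s \<le> t\<close> in simp)
qed simp

lemma tendsto_at_top_of_Cauchy:
  fixes f :: "real \<Rightarrow> 'a :: banach"
  assumes "\<And>e. e > 0 \<Longrightarrow> \<exists>T. \<forall>s\<ge>T. \<forall>t\<ge>T. norm (f t - f s) < e"
  obtains L where "(f \<longlongrightarrow> L) at_top"
proof -
  have "Cauchy (\<lambda>n. f (real n))"
  proof (rule CauchyI)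
    fix e :: real assume "e > 0"
    then obtain T where T: "\<forall>s\<ge>T. \<forall>t\<ge>T. norm (f t - f s) < e"
      using assms by blast
    obtain M where "real M \<ge> T"
      using real_arch_simple by blast
    then show "\<exists>M. \<forall>m\<ge>M. \<forall>n\<ge>M. norm (f (real m) - f (real n)) < e"
      using T by (intro exI[of _ M]) (auto intro: order_trans)
  qed
  then obtain L where L: "(\<lambda>n. f (real n)) \<longlonglongrightarrow> L"
    using Cauchy_convergent convergent_def by blast
  have "(f \<longlongrightarrow> L) at_top"
  proof (rule tendstoI)
    fix e :: real assume "e > 0"
    then obtain T where T: "\<forall>s\<ge>T. \<forall>t\<ge>T. norm (f t - f s) < e / 2"
      using assms[of "e / 2"] by auto
    have "dist (f t) L < e" if "t \<ge> T" for t
    proof -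
      have "eventually (\<lambda>n. real n \<ge> T) sequentially"
        using filterlim_real_sequentially by (simp add: filterlim_at_top)
      then have "eventually (\<lambda>n. norm (f t - f (real n)) \<le> e / 2) sequentially"
        by (rule eventually_mono) (use T that in \<open>auto intro: less_imp_le\<close>)
      moreover have "(\<lambda>n. norm (f t - f (real n))) \<longlonglongrightarrow> norm (f t - L)"
        by (intro tendsto_intros L)
      ultimately have "norm (f t - L) \<le> e / 2"
        using tendsto_upperbound by fastforce
      then show ?thesis
        using \<open>e > 0\<close> by (simp add: dist_norm)
    qed
    then show "eventually (\<lambda>t. dist (f t) L < e) at_top"
      using eventually_at_top_linorder by blast
  qed
  then show ?thesis using that by blast
qed

text \<open>
  The function \<open>g\<close> bounds the length that is still to come; being nonincreasing and bounded below, it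
  varies arbitrarily little once it is near its infimum.
\<close>

lemma tendsto_at_top_of_finite_length:
  fixes f :: "real \<Rightarrow> 'a :: banach"
  assumes "\<And>t. t \<ge> a \<Longrightarrow> g t \<ge> 0"
    and len: "\<And>s t. a \<le> s \<Longrightarrow> s \<le> t \<Longrightarrow> norm (f t - f s) \<le> g s - g t"
  obtains L where "(f \<longlongrightarrow> L) at_top"
proof (rule tendsto_at_top_of_Cauchy)
  fix e :: real assume "e > 0"
  have bdd: "bdd_below (g ` {a..})"
    using assms(1) by (intro bdd_belowI[of _ 0]) auto
  have "Inf (g ` {a..}) < Inf (g ` {a..}) + e"
    using \<open>e > 0\<close> by simp
  then obtain T where T: "T \<ge> a" "g T < Inf (g ` {a..}) + e"
    using cInf_less_iff[OF _ bdd, of "Inf (g ` {a..}) + e"] by auto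
  have *: "norm (f t - f s) < e" if "T \<le> s" "s \<le> t" for s t
  proof -
    have "g t \<ge> Inf (g ` {a..})"
      using that T by (intro cInf_lower bdd) auto
    moreover have "norm (f s - f T) \<le> g T - g s" "norm (f t - f s) \<le> g s - g t"
      using that T by (intro len; simp)+
    then have "norm (f t - f s) \<le> g T - g t"
      using norm_ge_zero[of "f s - f T"] by linarith
    ultimately show ?thesis using T by linarith
  qed
  have "norm (f t - f s) < e" if "T \<le> s" "T \<le> t" for s t
    using *[of s t] *[of t s] that by (cases "s \<le> t") (auto simp: norm_minus_commute)
  then show "\<exists>T. \<forall>s\<ge>T. \<forall>t\<ge>T. norm (f t - f s) < e" by blast
qed (use that in blast)

section \<open>The flow of complex matrices\<close>

lemma bounded_bilinear_bracket: "bounded_bilinear (bracket :: complex ^ 'n ^ 'n \<Rightarrow> _)"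
proof
  show "\<exists>K. \<forall>(A :: complex ^ 'n ^ 'n) (B :: complex ^ 'n ^ 'n).
      norm (bracket A B) \<le> norm A * norm B * K"
  proof (intro exI[of _ 2] allI)
    fix A B :: "complex ^ 'n ^ 'n"
    show "norm (bracket A B) \<le> norm A * norm B * 2"
      using norm_cmult_le[of A B] norm_cmult_le[of B A]
        norm_triangle_ineq4[of "A ** B" "B ** A"]
      by (simp add: bracket_def algebra_simps)
  qed
qed (simp_all add: bracket_def cmult.add_left cmult.add_right cmult.scaleR_left cmult.scaleR_right
    algebra_simps)

interpretation bracket: bounded_bilinear "bracket :: complex ^ 'n ^ 'n \<Rightarrow> _"
  by (rule bounded_bilinear_bracket)

lemma norm_bracket_le: "norm (bracket A B) \<le> 2 * norm A * norm B"
  using norm_cmult_le[of A B] norm_cmult_le[of B A] norm_triangle_ineq4[of "A ** B" "B ** A"]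
  by (simp add: bracket_def algebra_simps)

lemma bounded_linear_adj: "bounded_linear (adj :: complex ^ 'n ^ 'n \<Rightarrow> _)"
  by (rule bounded_linear_intro[of _ 1]) (simp_all add: adj_add, simp add: adj_def vec_eq_iff)

lemma adj_bracket: "adj (bracket A B) = bracket (adj B) (adj A)"
  by (simp add: bracket_def adj_diff adj_mult)

text \<open>
  The induction works because \<open>X \<mapsto> [X, G]\<close> is a derivation of the matrix algebra.
\<close>

lemma peval_has_vector_derivative:
  fixes B :: "real \<Rightarrow> complex ^ 'n ^ 'n"
  assumes "(B has_vector_derivative bracket (B t) G) (at t within S)"
  shows "((\<lambda>t. peval q (B t)) has_vector_derivative bracket (peval q (B t)) G) (at t within S)"
proof (induction q)
  case (pCons a q)
  have "bracket (peval (pCons a q) (B t)) G =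
      B t ** bracket (peval q (B t)) G + bracket (B t) G ** peval q (B t)"
    by (simp add: bracket_def cmult_distribs mat_mult_commute)
  moreover have "((\<lambda>t. mat a + B t ** peval q (B t)) has_vector_derivative
      0 + (B t ** bracket (peval q (B t)) G + bracket (B t) G ** peval q (B t))) (at t within S)"
    by (intro has_vector_derivative_add has_vector_derivative_const
        cmult.has_vector_derivative assms pCons.IH)
  ultimately show ?case by simp
qed (simp add: bracket.zero_left)

definition double_bracket_flow :: "(real \<Rightarrow> complex ^ 'n ^ 'n) \<Rightarrow> bool" where
  "double_bracket_flow B \<longleftrightarrow> (\<forall>t\<ge>0. (B has_vector_derivative
     4 *\<^sub>R bracket (B t) (bracket (B t) (adj (B t)))) (at t within {0..}))"

lemma double_bracket_flow_derivative:
  assumes "double_bracket_flow B" "a \<ge> 0" "t \<in> {a..b}"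
  shows "(B has_vector_derivative 4 *\<^sub>R bracket (B t) (bracket (B t) (adj (B t)))) (at t within {a..b})"
  by (rule has_vector_derivative_within_subset[of _ _ _ "{0..}"])
    (use assms in \<open>auto simp: double_bracket_flow_def\<close>)

lemma double_bracket_flow_norm_le:
  assumes flow: "double_bracket_flow B" and "t \<ge> 0"
  shows "norm (B t) \<le> norm (B 0)"
proof -
  have "B t \<bullet> B t \<le> B 0 \<bullet> B 0"
    by (rule nonincreasing_of_nonpos_derivative[OF assms(2)
          has_real_derivative_inner_self[OF double_bracket_flow_derivative[OF flow]]])
      (auto simp: inner_gradient_self)
  then show ?thesis
    by (simp add: norm_eq_sqrt_inner)
qed

text \<open>
  Every polynomial \<open>Y\<close> in \<open>B\<close> solves the linear equation \<open>Y' = [Y, 4 C]\<close>, whose coefficient is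
  bounded along the flow, so it vanishes either always or never.
\<close>

lemma double_bracket_flow_peval_eq_zero:
  assumes flow: "double_bracket_flow B" and "s \<ge> 0" "t \<ge> 0" "peval q (B s) = 0"
  shows "peval q (B t) = 0"
proof -
  define C where "C x = bracket (B x) (adj (B x))" for x
  define R where "R = norm (B 0)"
  define b where "b = max s t"
  show ?thesis
  proof (rule vanishing_of_linear_bound[where a = 0 and b = b and s = s])
    fix x assume x: "x \<in> {0..b}"
    have "(B has_vector_derivative bracket (B x) (4 *\<^sub>R C x)) (at x within {0..b})"
      using double_bracket_flow_derivative[OF flow _ x] by (simp add: C_def bracket.scaleR_right)
    then show "((\<lambda>x. peval q (B x)) has_vector_derivative bracket (peval q (B x)) (4 *\<^sub>R C x))
        (at x within {0..b})"
      by (rule peval_has_vector_derivative)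
    have "norm (B x) \<le> R"
      using double_bracket_flow_norm_le[OF flow] x by (simp add: R_def)
    then have "norm (B x) * norm (B x) \<le> R * R"
      by (intro mult_mono) (auto simp: R_def)
    then have "norm (C x) \<le> 2 * (R * R)"
      using norm_bracket_le[of "B x" "adj (B x)"] by (simp add: C_def)
    then have "norm (peval q (B x)) * norm (C x) \<le> norm (peval q (B x)) * (2 * (R * R))"
      by (intro mult_left_mono) auto
    then show "norm (bracket (peval q (B x)) (4 *\<^sub>R C x)) \<le> 16 * R * R * norm (peval q (B x))"
      using norm_bracket_le[of "peval q (B x)" "4 *\<^sub>R C x"] by (simp add: mult_ac)
  qed (use assms in \<open>auto simp: b_def\<close>)
qed

lemma double_bracket_flow_commutator_derivative:
  fixes B :: "real \<Rightarrow> complex ^ 'n ^ 'n"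
  assumes "(B has_vector_derivative 4 *\<^sub>R bracket (B t) (bracket (B t) (adj (B t)))) (at t within S)"
  shows "((\<lambda>t. (norm (bracket (B t) (adj (B t))))\<^sup>2) has_real_derivative
    - 16 * (norm (bracket (B t) (bracket (B t) (adj (B t)))))\<^sup>2) (at t within S)"
proof -
  define C where "C t = bracket (B t) (adj (B t))" for t
  define G where "G = bracket (B t) (C t)"
  define H where "H = 4 *\<^sub>R G"
  have dB: "(B has_vector_derivative H) (at t within S)"
    using assms by (simp add: H_def G_def C_def)
  have dC: "(C has_vector_derivative bracket (B t) (adj H) + bracket H (adj (B t))) (at t within S)"
    unfolding C_def
    by (intro bracket.has_vector_derivative dB
        bounded_linear.has_vector_derivative[OF bounded_linear_adj])
  have h1: "bracket H (adj (B t)) \<bullet> C t = - (H \<bullet> G)"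
    by (simp add: bracket_def[of H] G_def bracket_def[of "B t" "C t"] inner_diff_left
        inner_diff_right inner_cmult_left[of _ H] inner_cmult_right[of H])
  have symC: "adj (C t) = C t"
    by (simp add: C_def adj_bracket)
  have h2: "bracket (B t) (adj H) \<bullet> C t = - (H \<bullet> G)"
    using h1 inner_adj[of "bracket H (adj (B t))" "C t"] by (simp add: symC adj_bracket)
  have "((\<lambda>t. C t \<bullet> C t) has_real_derivative - 16 * (norm G)\<^sup>2) (at t within S)"
    using has_real_derivative_inner_self[OF dC]
    by (simp add: inner_add_left h1 h2) (simp add: H_def power2_norm_eq_inner)
  then show ?thesis
    by (simp add: C_def G_def power2_norm_eq_inner)
qed

text \<open>
  The squared norm \<open>\<parallel>C\<parallel>\<^sup>2\<close> has derivative \<open>- 16 \<parallel>G\<parallel>\<^sup>2\<close> and the speed is \<open>4 \<parallel>G\<parallel>\<close>. The gradient inequality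
  \<open>\<parallel>C\<parallel>\<^bsup>3/2\<^esup> \<le> K \<parallel>G\<parallel>\<close> says precisely that the speed is at most the rate at which \<open>K \<parallel>C\<parallel>\<^bsup>1/2\<^esup>\<close> decreases,
  so that this quantity bounds the remaining length. Where \<open>C\<close> vanishes the square root is not
  differentiable, but from then on the curve is constant.
\<close>

lemma double_bracket_flow_converges:
  fixes B :: "real \<Rightarrow> complex ^ 'n ^ 'n"
  assumes flow: "double_bracket_flow B"
  obtains L where "(B \<longlongrightarrow> L) at_top"
proof -
  define C where "C t = bracket (B t) (adj (B t))" for t
  define G where "G t = bracket (B t) (C t)" for t
  obtain z :: "nat \<Rightarrow> complex" and m where "peval (\<Prod>i<m. [:- z i, 1:]) (B 0) = 0"
    by (rule split_annihilating_poly_exists)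
  then have ann: "peval (\<Prod>i<m. [:- z i, 1:]) (B t) = 0" if "t \<ge> 0" for t
    using double_bracket_flow_peval_eq_zero[OF flow _ that, of 0] by simp
  obtain K where K: "K > 0" "\<And>A :: complex ^ 'n ^ 'n. norm A \<le> norm (B 0) \<Longrightarrow>
      peval (\<Prod>i<m. [:- z i, 1:]) A = 0 \<Longrightarrow>
       norm (bracket A (adj A)) * sqrt (norm (bracket A (adj A)))
         \<le> K * norm (bracket A (bracket A (adj A)))"
    by (rule self_commutator_gradient_inequality[where R = "norm (B 0)" and m = m and z = z]) blast
  have ineq: "norm (C t) * sqrt (norm (C t)) \<le> K * norm (G t)" if "t \<ge> 0" for t
    using K(2)[OF double_bracket_flow_norm_le[OF flow that] ann[OF that]]
    by (simp add: C_def G_def)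
  have dB: "(B has_vector_derivative 4 *\<^sub>R G t) (at t within {a..b})"
    if "a \<ge> 0" "t \<in> {a..b}" for a b t
    using double_bracket_flow_derivative[OF flow that] by (simp add: G_def C_def)
  have dC: "((\<lambda>t. (norm (C t))\<^sup>2) has_real_derivative - 16 * (norm (G t))\<^sup>2) (at t within {a..b})"
    if "a \<ge> 0" "t \<in> {a..b}" for a b t
    using double_bracket_flow_commutator_derivative[OF double_bracket_flow_derivative[OF flow that]]
    by (simp add: G_def C_def)
  have decr: "norm (C t) \<le> norm (C s)" if "0 \<le> s" "s \<le> t" for s t
  proof -
    have "(norm (C t))\<^sup>2 \<le> (norm (C s))\<^sup>2"
      by (rule nonincreasing_of_nonpos_derivative[OF that(2) dC[OF that(1)]]) auto
    then show ?thesis by (simp add: power2_le_iff_abs_le)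
  qed
  show ?thesis
  proof (cases "\<exists>T\<ge>0. C T = 0")
    case True
    then obtain T where T: "T \<ge> 0" "C T = 0" by blast
    then have G0: "G t = 0" if "t \<ge> T" for t
      using decr[of T t] that by (simp add: G_def bracket.zero_right)
    have len: "norm (B t - B s) \<le> 0 - 0" if st: "T \<le> s" "s \<le> t" for s t
    proof (rule norm_diff_le_of_speed_le[OF st(2)])
      show "(B has_vector_derivative 4 *\<^sub>R G x) (at x within {s..t})" if "x \<in> {s..t}" for x
        using dB[OF _ that] st T by simp
      show "norm (4 *\<^sub>R G x) \<le> 0" if "x \<in> {s..t}" for x
        using G0[of x] that st by simp
    qed simp
    show ?thesis
      by (rule tendsto_at_top_of_finite_length[where f = B and a = T and g = "\<lambda>_. 0"])
        (use len that in blast)+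
  next
    case False
    then have pos: "norm (C t) > 0" if "t \<ge> 0" for t
      using that by auto
    have len: "norm (B t - B s) \<le> K * sqrt (norm (C s)) - K * sqrt (norm (C t))" if st: "0 \<le> s" "s \<le> t" for s t
    proof -
      \<comment> \<open>The double root presents \<open>\<parallel>C\<parallel>\<^bsup>1/2\<^esup>\<close> as a function of the differentiable \<open>\<parallel>C\<parallel>\<^sup>2\<close>.\<close>
      define \<psi> where "\<psi> = (\<lambda>t. - K * sqrt (sqrt ((norm (C t))\<^sup>2)))"
      define \<psi>' where "\<psi>' t = 4 * K * (norm (G t))\<^sup>2 / (norm (C t) * sqrt (norm (C t)))" for t
      have d\<psi>: "(\<psi> has_real_derivative \<psi>' x) (at x within {s..t})" if x: "x \<in> {s..t}" for x
      proof -
        have n: "norm (C x) > 0" using pos x st by simp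
        define e where "e = - 16 * (norm (G x))\<^sup>2"
        have 1: "((\<lambda>t. sqrt ((norm (C t))\<^sup>2)) has_real_derivative inverse (norm (C x)) / 2 * e)
            (at x within {s..t})"
          using DERIV_chain2[OF DERIV_real_sqrt dC[OF st(1) x]] n by (simp add: e_def)
        have 2: "((\<lambda>t. sqrt (sqrt ((norm (C t))\<^sup>2))) has_real_derivative
            inverse (sqrt (norm (C x))) / 2 * (inverse (norm (C x)) / 2 * e)) (at x within {s..t})"
          using DERIV_chain2[OF DERIV_real_sqrt 1] n by simp
        have "- K * (inverse (sqrt n) / 2 * (inverse n / 2 * (- 16 * g))) = 4 * K * g / (n * sqrt n)"
          for n g
          by (simp add: field_simps)
        then have eq: "- K * (inverse (sqrt (norm (C x))) / 2 * (inverse (norm (C x)) / 2 * e)) = \<psi>' x"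
          unfolding \<psi>'_def e_def by blast
        show ?thesis
          using DERIV_cmult[OF 2, of "- K"] unfolding eq \<psi>_def .
      qed
      have "norm (4 *\<^sub>R G x) \<le> \<psi>' x" if x: "x \<in> {s..t}" for x
      proof -
        have c: "norm (C x) * sqrt (norm (C x)) > 0"
          using pos[of x] x st by simp
        have "norm (G x) * (norm (C x) * sqrt (norm (C x))) \<le> norm (G x) * (K * norm (G x))"
          using ineq[of x] x st by (intro mult_left_mono) auto
        then show ?thesis
          using c by (simp add: \<psi>'_def pos_le_divide_eq power2_eq_square mult_ac)
      qed
      then have "norm (B t - B s) \<le> \<psi> t - \<psi> s"
        using st by (intro norm_diff_le_of_speed_le[OF st(2) dB d\<psi>]) auto
      then show ?thesis by (simp add: \<psi>_def)
    qed
    have nonneg: "0 \<le> K * sqrt (norm (C t))" for t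
      using K(1) by simp
    show ?thesis
      by (rule tendsto_at_top_of_finite_length[where f = B and a = 0
            and g = "\<lambda>t. K * sqrt (norm (C t))"]) (use len nonneg that in blast)+
  qed
qed

lemma peval_X_power: "peval ([:0, 1:] ^ k) A = ((**) A ^^ k) (mat 1)"
  by (induction k) (simp_all add: peval_mult mat_zero del: mult_pCons_left)

text \<open>
  Let \<open>q\<close> annihilate the curve and write \<open>q = x\<^sup>a r\<close> with \<open>r\<close> not vanishing at \<open>0\<close>. When \<open>B T\<close> is close to \<open>0\<close>,
  the matrix \<open>r(B T)\<close> is close to a nonzero scalar matrix and cannot annihilate anything but \<open>0\<close>. So
  \<open>(B T)\<^sup>a = 0\<close>, and the vanishing of this polynomial propagates back to time zero.
\<close>

lemma double_bracket_flow_limit_zero_imp_nilpotent: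
  fixes B :: "real \<Rightarrow> complex ^ 'n ^ 'n"
  assumes flow: "double_bracket_flow B" and lim: "(B \<longlongrightarrow> 0) at_top"
  shows "\<exists>k. ((**) (B 0) ^^ k) (mat 1) = 0"
proof -
  obtain q where q: "q \<noteq> 0" "peval q (B 0) = 0"
    by (rule annihilating_poly_exists)
  obtain r where r: "q = [:0, 1:] ^ order 0 q * r" "\<not> [:0, 1:] dvd r"
    using order_decomp[OF q(1), of 0] by auto
  define w where "w = poly r 0"
  have w: "w \<noteq> 0"
    using r(2) poly_eq_0_iff_dvd[of r 0] by (simp add: w_def)
  obtain u where u: "\<And>A :: complex ^ 'n ^ 'n. peval r A - mat (poly r 0) = peval u A ** (A - mat 0)"
    using peval_minus_value[of r 0] by blast
  obtain K where K: "K \<ge> 0" "\<And>A :: complex ^ 'n ^ 'n. norm A \<le> norm (B 0) \<Longrightarrow> norm (peval u A) \<le> K"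
    using peval_bounded[of "norm (B 0)" u] by blast
  have "norm w / (K + 1) > 0"
    using w K(1) by simp
  from tendstoD[OF lim this] have "eventually (\<lambda>t. norm (B t) < norm w / (K + 1)) at_top"
    by simp
  then have "eventually (\<lambda>t. t \<ge> 0 \<and> norm (B t) < norm w / (K + 1)) at_top"
    using eventually_ge_at_top by (rule eventually_conj[rotated])
  then obtain T where T: "T \<ge> 0" "norm (B T) < norm w / (K + 1)"
    by (metis (mono_tags, lifting) eventually_at_top_linorder order_refl)
  define X where "X = peval ([:0, 1:] ^ order 0 q) (B T)"
  have "peval q (B T) = 0"
    using double_bracket_flow_peval_eq_zero[OF flow _ T(1) q(2)] by simp
  then have "peval r (B T) ** X = 0"
    using r(1) unfolding X_def by (metis peval_mult peval_commute)
  moreover have "peval r (B T) = mat w + peval u (B T) ** B T"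
    using u[of "B T"] by (simp add: w_def mat_zero algebra_simps)
  ultimately have "mat w ** X = - (peval u (B T) ** B T ** X)"
    by (simp add: cmult.add_left eq_neg_iff_add_eq_0)
  then have "norm w * norm X = norm (peval u (B T) ** B T ** X)"
    by (metis norm_mat_mult norm_minus_cancel)
  also have "\<dots> \<le> norm (peval u (B T)) * norm (B T) * norm X"
    by (meson mult_right_mono norm_cmult_le norm_ge_zero order_trans)
  also have "\<dots> \<le> K * norm (B T) * norm X"
    using K(2)[OF double_bracket_flow_norm_le[OF flow T(1)]] by (intro mult_right_mono) auto
  finally have "(norm w - K * norm (B T)) * norm X \<le> 0"
    by (simp add: algebra_simps)
  moreover have "norm w - K * norm (B T) > 0"
  proof -
    have "(K + 1) * norm (B T) < norm w"
      using T(2) K(1) by (simp add: pos_less_divide_eq mult.commute)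
    then show ?thesis
      unfolding distrib_right using norm_ge_zero[of "B T"] by linarith
  qed
  ultimately have "X = 0"
    by (simp add: mult_le_0_iff not_le)
  then have "peval ([:0, 1:] ^ order 0 q) (B 0) = 0"
    using double_bracket_flow_peval_eq_zero[OF flow T(1), of 0] by (simp add: X_def)
  then show ?thesis
    by (auto simp: peval_X_power)
qed

section \<open>Real matrices\<close>

definition complexify :: "real ^ 'n ^ 'n \<Rightarrow> complex ^ 'n ^ 'n" where
  "complexify A = (\<chi> i j. complex_of_real (A $ i $ j))"

lemma complexify_mult: "complexify (A ** B) = complexify A ** complexify B"
  by (simp add: complexify_def vec_eq_iff matrix_matrix_mult_def)

lemma complexify_diff: "complexify (A - B) = complexify A - complexify B"
  by (simp add: complexify_def vec_eq_iff)

lemma complexify_mat: "complexify (mat 1) = mat 1"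
  by (simp add: complexify_def vec_eq_iff mat_def)

lemma complexify_eq_0_iff: "complexify A = 0 \<longleftrightarrow> A = 0"
  by (simp add: complexify_def vec_eq_iff)

lemma norm_complexify: "norm (complexify A) = norm A"
  by (simp add: complexify_def norm_vec_def)

lemma complexify_transpose: "complexify (transpose A) = adj (complexify A)"
  by (simp add: complexify_def vec_eq_iff adj_def transpose_def)

lemma complexify_commutator: "complexify (commutator A B) = bracket (complexify A) (complexify B)"
  by (simp add: commutator_def bracket_def complexify_diff complexify_mult)

lemma bounded_linear_complexify: "bounded_linear (complexify :: real ^ 'n ^ 'n \<Rightarrow> _)"
  by (rule bounded_linear_intro[of _ 1])
    (simp_all add: norm_complexify, simp_all add: complexify_def vec_eq_iff of_real_def scaleR_left_distrib)

lemma norm_commutator_le: "norm (commutator A B) \<le> 2 * norm A * norm B"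
  using norm_bracket_le[of "complexify A" "complexify B"]
  by (simp add: complexify_commutator[symmetric] norm_complexify)

lemma norm_transpose: "norm (transpose A) = norm A" for A :: "real ^ 'n ^ 'n"
  by (simp add: norm_eq_sqrt_inner inner_transpose)

interpretation commutator: bounded_bilinear "commutator :: real ^ 'n ^ 'n \<Rightarrow> _"
  by (rule bounded_bilinear_commutator)

lemma double_bracket_flow_complexify:
  assumes "is_neg_gradient_flow comm_functional B"
  shows "double_bracket_flow (\<lambda>t. complexify (B t))"
  unfolding double_bracket_flow_def
proof (intro allI impI)
  fix t :: real assume "t \<ge> 0"
  then have "(B has_vector_derivative 4 *\<^sub>R commutator (B t) (commutator (B t) (transpose (B t))))
      (at t within {0..})"
    using assms by (simp add: neg_gradient_flow_comm_functional_iff)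
  from bounded_linear.has_vector_derivative[OF bounded_linear_complexify this]
  show "((\<lambda>t. complexify (B t)) has_vector_derivative 4 *\<^sub>R bracket (complexify (B t))
      (bracket (complexify (B t)) (adj (complexify (B t))))) (at t within {0..})"
    by (simp add: complexify_commutator complexify_transpose
        linear_scale[OF bounded_linear.linear[OF bounded_linear_complexify]])
qed

lemma neg_gradient_flow_converges:
  fixes B :: "real \<Rightarrow> real ^ 'n ^ 'n"
  assumes flow: "is_neg_gradient_flow comm_functional B" and "\<not> nilpotent_matrix (B 0)"
  obtains L where "(B \<longlongrightarrow> L) at_top" "L \<noteq> 0"
proof -
  note cflow = double_bracket_flow_complexify[OF flow]
  obtain L where L: "((\<lambda>t. complexify (B t)) \<longlongrightarrow> L) at_top"
    using double_bracket_flow_converges[OF cflow] by blast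
  define L' :: "real ^ 'n ^ 'n" where "L' = (\<chi> i j. Re (L $ i $ j))"
  have "((\<lambda>t. \<chi> i j. Re (complexify (B t) $ i $ j)) \<longlongrightarrow> L') at_top"
    unfolding L'_def by (intro tendsto_intros L)
  then have lim: "(B \<longlongrightarrow> L') at_top"
    by (simp add: complexify_def)
  moreover have "L' \<noteq> 0"
  proof
    assume "L' = 0"
    then have "((\<lambda>t. complexify (B t)) \<longlongrightarrow> complexify 0) at_top"
      using bounded_linear.tendsto[OF bounded_linear_complexify lim] by simp
    then have "((\<lambda>t. complexify (B t)) \<longlongrightarrow> 0) at_top"
      using complexify_eq_0_iff by metis
    then obtain k where "((**) (complexify (B 0)) ^^ k) (mat 1) = 0"
      using double_bracket_flow_limit_zero_imp_nilpotent[OF cflow] by blast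
    moreover have "((**) (complexify X) ^^ k) (mat 1) = complexify (((**) X ^^ k) (mat 1))"
      for X :: "real ^ 'n ^ 'n" and k
      by (induction k) (simp_all add: complexify_mult complexify_mat)
    ultimately show False
      using assms(2) by (auto simp: nilpotent_matrix_def complexify_eq_0_iff)
  qed
  ultimately show ?thesis using that by blast
qed

lemma neg_gradient_flow_norm_le:
  assumes "is_neg_gradient_flow comm_functional B" "t \<ge> 0"
  shows "norm (B t) \<le> norm (B 0)"
  using double_bracket_flow_norm_le[OF double_bracket_flow_complexify[OF assms(1)] assms(2)]
  by (simp add: norm_complexify)

section \<open>The bracket flow as a rescaled gradient flow\<close>

definition double_bracket :: "real ^ 'n ^ 'n \<Rightarrow> real ^ 'n ^ 'n" where
  "double_bracket A = commutator A (commutator A (transpose A))"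

lemma double_bracket_scaleR: "double_bracket (c *\<^sub>R A) = c ^ 3 *\<^sub>R double_bracket A"
  by (simp add: double_bracket_def commutator.scaleR_left commutator.scaleR_right transpose_scalar
      power3_eq_cube)

text \<open>
  The vector field is Lipschitz on balls, which is what uniqueness of solutions rests on. As a
  trilinear expression it changes by three terms, one for each argument replaced.
\<close>

lemma norm_double_bracket_diff_le:
  assumes X: "norm X \<le> M" and Y: "norm Y \<le> M"
  shows "norm (double_bracket X - double_bracket Y) \<le> 12 * M\<^sup>2 * norm (X - Y)"
proof -
  have M: "M \<ge> 0"
    using X norm_ge_zero order_trans by blast
  define d where "d = norm (X - Y)"
  have nest: "norm (commutator U (commutator V W)) \<le> 4 * (norm U * norm V * norm W)"
    for U V W :: "real ^ 'a ^ 'a"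
  proof -
    have "norm (commutator U (commutator V W)) \<le> 2 * norm U * (2 * norm V * norm W)"
      using norm_commutator_le[of U "commutator V W"]
        mult_left_mono[OF norm_commutator_le[of V W], of "2 * norm U"] by simp
    then show ?thesis by (simp add: mult_ac)
  qed
  have eq: "double_bracket X - double_bracket Y = commutator (X - Y) (commutator X (transpose X))
      + commutator Y (commutator (X - Y) (transpose X))
      + commutator Y (commutator Y (transpose (X - Y)))"
    by (simp add: double_bracket_def transpose_diff commutator.diff_left commutator.diff_right)
  have 1: "norm (commutator (X - Y) (commutator X (transpose X))) \<le> 4 * (d * M * M)"
    by (rule order_trans[OF nest]) (intro mult_mono mult_left_mono; use X Y M in \<open>simp add: d_def norm_transpose\<close>)
  have 2: "norm (commutator Y (commutator (X - Y) (transpose X))) \<le> 4 * (M * d * M)"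
    by (rule order_trans[OF nest]) (intro mult_mono mult_left_mono; use X Y M in \<open>simp add: d_def norm_transpose\<close>)
  have 3: "norm (commutator Y (commutator Y (transpose (X - Y)))) \<le> 4 * (M * M * d)"
    by (rule order_trans[OF nest]) (intro mult_mono mult_left_mono; use X Y M in \<open>simp add: d_def norm_transpose\<close>)
  have "norm (double_bracket X - double_bracket Y) \<le> 4 * (d * M * M) + 4 * (M * d * M) + 4 * (M * M * d)"
    unfolding eq by (intro norm_triangle_le add_mono 1 2 3)
  then show ?thesis
    by (simp add: d_def power2_eq_square mult_ac)
qed

lemma trace_sym_part_square: "trace (sym_part A ** sym_part A) = (norm (sym_part A))\<^sup>2"
proof -
  have "transpose (sym_part A) = sym_part A"
    by (simp add: sym_part_def transpose_def vec_eq_iff add.commute)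
  then show ?thesis
    by (simp add: norm_matrix_eq_trace)
qed

lemma norm_sym_part_le: "norm (sym_part A) \<le> norm A"
  using norm_triangle_ineq[of A "transpose A"] by (simp add: sym_part_def norm_transpose)

lemma trace_bracket_flow_rhs:
  "trace (bracket_flow_rhs A) = - trace (sym_part A ** sym_part A) * trace A"
proof -
  have tr0: "trace (commutator X Y) = 0" for X Y :: "real ^ 'n ^ 'n"
    by (simp add: commutator_def trace_sub trace_mul_sym[of X Y])
  have trc: "trace (c *\<^sub>R X) = c * trace X" for c and X :: "real ^ 'n ^ 'n"
    by (simp add: trace_def sum_distrib_left)
  show ?thesis
    by (simp add: bracket_flow_rhs_def trace_sub trace_add trc tr0)
qed

lemma bounded_linear_trace: "bounded_linear (trace :: real ^ 'n ^ 'n \<Rightarrow> real)"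
  unfolding linear_conv_bounded_linear[symmetric]
  by (auto intro!: linearI simp: trace_def sum.distrib sum_distrib_left)

lemma bounded_linear_sym_part: "bounded_linear (sym_part :: real ^ 'n ^ 'n \<Rightarrow> _)"
  unfolding linear_conv_bounded_linear[symmetric]
  by (auto intro!: linearI simp: sym_part_def transpose_def vec_eq_iff algebra_simps)

lemma continuous_curve_bounded:
  fixes f :: "real \<Rightarrow> 'a :: real_normed_vector"
  assumes "continuous_on {0..b} f"
  obtains M where "M > 0" "\<And>t. t \<in> {0..b} \<Longrightarrow> norm (f t) \<le> M"
  using compact_imp_bounded[OF compact_continuous_image[OF assms compact_Icc]]
  unfolding bounded_pos by auto

text \<open>
  Since commutators are traceless, the trace solves a scalar linear homogeneous equation. Its
  vanishing removes the term with the factor \<open>trace A\<close> from the bracket flow.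
\<close>

lemma bracket_flow_trace_zero:
  fixes A :: "real \<Rightarrow> real ^ 'n ^ 'n"
  assumes der: "\<And>t. t \<ge> 0 \<Longrightarrow> (A has_vector_derivative bracket_flow_rhs (A t)) (at t within {0..})"
    and "trace (A 0) = 0" "t \<ge> 0"
  shows "trace (A t) = 0"
proof -
  have der': "(A has_vector_derivative bracket_flow_rhs (A x)) (at x within {0..t})"
    if "x \<in> {0..t}" for x
    by (rule has_vector_derivative_within_subset[OF der]) (use that in auto)
  then have "continuous_on {0..t} A"
    using has_vector_derivative_continuous continuous_on_eq_continuous_within by blast
  then obtain M where M: "M > 0" "\<And>x. x \<in> {0..t} \<Longrightarrow> norm (A x) \<le> M"
    using continuous_curve_bounded by blast
  show ?thesis
  proof (rule vanishing_of_linear_bound[where Y = "\<lambda>x. trace (A x)" and a = 0 and b = t and s = 0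
        and K = "M\<^sup>2" and Y' = "\<lambda>x. trace (bracket_flow_rhs (A x))"])
    fix x assume x: "x \<in> {0..t}"
    show "((\<lambda>x. trace (A x)) has_vector_derivative trace (bracket_flow_rhs (A x))) (at x within {0..t})"
      by (rule bounded_linear.has_vector_derivative[OF bounded_linear_trace der'[OF x]])
    have "(norm (sym_part (A x)))\<^sup>2 \<le> M\<^sup>2"
      using norm_sym_part_le[of "A x"] M(2)[OF x] by (intro power_mono) auto
    then show "norm (trace (bracket_flow_rhs (A x))) \<le> M\<^sup>2 * norm (trace (A x))"
      by (simp add: trace_bracket_flow_rhs trace_sym_part_square abs_mult mult_right_mono)
  qed (use assms in auto)
qed

text \<open>
  The choices \<open>c' = - s c\<close> and \<open>\<tau>' = c\<^sup>2 / 8\<close> make \<open>c t *\<^sub>R B (\<tau> t)\<close> solve the equation of \<open>A\<close>: the first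
  produces the linear term, and the second accounts for the cubic homogeneity and for the ratio of the
  factors \<open>4\<close> and \<open>1/2\<close>.

  The reparametrisation exhausts the half-line because \<open>B\<close> is bounded, by \<open>R\<close> say: then \<open>s \<le> R\<^sup>2 c\<^sup>2 = 8 R\<^sup>2 \<tau>'\<close>,
  so \<open>c\<^sup>2 \<ge> e\<^bsup>-16 R\<^sup>2 \<tau>\<^esup>\<close>, and the derivative of \<open>e\<^bsup>16 R\<^sup>2 \<tau>\<^esup>\<close> is at least \<open>2 R\<^sup>2\<close>.
\<close>

lemma bracket_flow_eq_rescaled_gradient_flow:
  fixes A B :: "real \<Rightarrow> real ^ 'n ^ 'n"
  assumes der: "\<And>t. t \<ge> 0 \<Longrightarrow> (A has_vector_derivative bracket_flow_rhs (A t)) (at t within {0..})"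
    and tr: "trace (A 0) = 0"
    and flow: "is_neg_gradient_flow comm_functional B"
    and "B 0 = A 0"
  obtains c \<tau> where "\<And>t. t \<ge> 0 \<Longrightarrow> c t > (0::real)" "\<And>t. t \<ge> 0 \<Longrightarrow> A t = c t *\<^sub>R B (\<tau> t)"
    "filterlim \<tau> at_top at_top"
proof -
  define s where "s t = (norm (sym_part (A t)))\<^sup>2" for t
  define \<sigma> where "\<sigma> t = integral {0..t} s" for t
  define c where "c t = exp (- \<sigma> t)" for t
  define \<tau> where "\<tau> t = integral {0..t} (\<lambda>x. (c x)\<^sup>2 / 8)" for t
  have dA: "(A has_vector_derivative (- s t *\<^sub>R A t + (1 / 2) *\<^sub>R double_bracket (A t))) (at t within {0..b})"
    if "t \<in> {0..b}" for t b
  proof -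
    have "bracket_flow_rhs (A t) = - s t *\<^sub>R A t + (1 / 2) *\<^sub>R double_bracket (A t)"
      using bracket_flow_trace_zero[OF der tr, of t] that
      by (simp add: bracket_flow_rhs_def s_def trace_sym_part_square double_bracket_def)
    then show ?thesis
      using has_vector_derivative_within_subset[OF der, of t "{0..b}"] that by auto
  qed
  have contA: "continuous_on {0..b} A" for b
    using dA has_vector_derivative_continuous continuous_on_eq_continuous_within by blast
  have conts: "continuous_on {0..b} s" for b
    unfolding s_def
    by (intro continuous_intros bounded_linear.continuous_on[OF bounded_linear_sym_part] contA)
  have d\<sigma>: "(\<sigma> has_real_derivative s t) (at t within {0..b})" if "t \<in> {0..b}" for t b
    unfolding \<sigma>_def by (rule integral_has_real_derivative[OF conts that])
  have dc: "(c has_real_derivative - s t * c t) (at t within {0..b})" if "t \<in> {0..b}" for t b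
    unfolding c_def by (auto intro!: derivative_eq_intros d\<sigma>[OF that])
  have contc: "continuous_on {0..b} c" for b
    using dc DERIV_continuous continuous_on_eq_continuous_within by blast
  have d\<tau>: "(\<tau> has_real_derivative (c t)\<^sup>2 / 8) (at t within {0..b})" if "t \<in> {0..b}" for t b
    unfolding \<tau>_def
    by (rule integral_has_real_derivative[OF _ that]) (intro continuous_intros contc; simp)
  have \<tau>0: "\<tau> t \<ge> 0" for t
    unfolding \<tau>_def
    by (intro integral_nonneg integrable_continuous_interval continuous_intros contc) auto
  define A' where "A' = (\<lambda>t. c t *\<^sub>R B (\<tau> t))"
  have dA': "(A' has_vector_derivative (- s t *\<^sub>R A' t + (1 / 2) *\<^sub>R double_bracket (A' t))) (at t within {0..b})"
    if t: "t \<in> {0..b}" for t b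
  proof -
    have "(B has_vector_derivative 4 *\<^sub>R double_bracket (B (\<tau> t))) (at (\<tau> t) within {0..})"
      using flow \<tau>0 by (simp add: neg_gradient_flow_comm_functional_iff double_bracket_def)
    then have "(B has_vector_derivative 4 *\<^sub>R double_bracket (B (\<tau> t))) (at (\<tau> t) within \<tau> ` {0..b})"
      by (rule has_vector_derivative_within_subset) (use \<tau>0 in auto)
    from vector_diff_chain_within[OF d\<tau>[OF t, unfolded has_real_derivative_iff_has_vector_derivative] this]
    have "((\<lambda>t. B (\<tau> t)) has_vector_derivative ((c t)\<^sup>2 / 2) *\<^sub>R double_bracket (B (\<tau> t))) (at t within {0..b})"
      by (simp add: o_def)
    from has_vector_derivative_scaleR[OF dc[OF t] this]
    show ?thesis
      by (simp add: A'_def double_bracket_scaleR power2_eq_square power3_eq_cube mult_ac)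
  qed
  have contA': "continuous_on {0..b} A'" for b
    using dA' has_vector_derivative_continuous continuous_on_eq_continuous_within by blast
  have A_eq: "A t = A' t" if "t \<ge> 0" for t
  proof -
    obtain M1 where M1: "M1 > 0" "\<And>x. x \<in> {0..t} \<Longrightarrow> norm (A x) \<le> M1"
      using continuous_curve_bounded[OF contA] by blast
    obtain M2 where M2: "M2 > 0" "\<And>x. x \<in> {0..t} \<Longrightarrow> norm (A' x) \<le> M2"
      using continuous_curve_bounded[OF contA'] by blast
    define M where "M = max M1 M2"
    let ?D = "\<lambda>x. - s x *\<^sub>R (A x - A' x) + (1 / 2) *\<^sub>R (double_bracket (A x) - double_bracket (A' x))"
    have "A t - A' t = 0"
    proof (rule vanishing_of_linear_bound[where Y = "\<lambda>x. A x - A' x" and Y' = ?D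
          and a = 0 and b = t and s = 0 and K = "M\<^sup>2 + 6 * M\<^sup>2"])
      fix x assume x: "x \<in> {0..t}"
      have nA: "norm (A x) \<le> M" "norm (A' x) \<le> M"
        using M1(2)[OF x] M2(2)[OF x] by (auto simp: M_def)
      show "((\<lambda>x. A x - A' x) has_vector_derivative ?D x) (at x within {0..t})"
        using has_vector_derivative_diff[OF dA[OF x] dA'[OF x]] by (simp add: algebra_simps)
      have "s x \<le> M\<^sup>2"
        unfolding s_def using norm_sym_part_le[of "A x"] nA(1) by (intro power_mono) auto
      then have 1: "norm (- s x *\<^sub>R (A x - A' x)) \<le> M\<^sup>2 * norm (A x - A' x)"
        by (simp add: mult_right_mono s_def)
      have 2: "norm ((1 / 2) *\<^sub>R (double_bracket (A x) - double_bracket (A' x))) \<le> 6 * M\<^sup>2 * norm (A x - A' x)"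
        using norm_double_bracket_diff_le[OF nA] by simp
      show "norm (?D x) \<le> (M\<^sup>2 + 6 * M\<^sup>2) * norm (A x - A' x)"
        unfolding distrib_right by (rule norm_triangle_le[OF add_mono[OF 1 2]])
    qed (use that assms in \<open>auto simp: A'_def c_def \<sigma>_def \<tau>_def\<close>)
    then show ?thesis by simp
  qed
  \<comment> \<open>The summand \<open>1\<close> only serves to make \<open>R\<close> positive, so that one can divide by it.\<close>
  define R where "R = norm (B 0) + 1"
  have R: "R > 0" by (simp add: R_def add_nonneg_pos)
  have s_le: "s t \<le> R\<^sup>2 * (c t)\<^sup>2" if "t \<ge> 0" for t
  proof -
    have "norm (sym_part (A t)) \<le> c t * norm (B (\<tau> t))"
      using norm_sym_part_le[of "A t"] A_eq[OF that] by (simp add: A'_def c_def)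
    also have "\<dots> \<le> c t * R"
      using neg_gradient_flow_norm_le[OF flow \<tau>0, of t] by (simp add: c_def R_def)
    finally have "(norm (sym_part (A t)))\<^sup>2 \<le> (c t * R)\<^sup>2"
      by (intro power_mono) auto
    then show ?thesis by (simp add: s_def power_mult_distrib mult.commute)
  qed
  have \<sigma>_le: "\<sigma> t \<le> 8 * R\<^sup>2 * \<tau> t" if "t \<ge> 0" for t
  proof -
    have "\<sigma> t - 8 * R\<^sup>2 * \<tau> t \<le> \<sigma> 0 - 8 * R\<^sup>2 * \<tau> 0"
    proof (rule nonincreasing_of_nonpos_derivative[OF that])
      fix x assume x: "x \<in> {0..t}"
      show "((\<lambda>t. \<sigma> t - 8 * R\<^sup>2 * \<tau> t) has_real_derivative s x - 8 * R\<^sup>2 * ((c x)\<^sup>2 / 8))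
          (at x within {0..t})"
        by (intro DERIV_diff DERIV_cmult d\<sigma> d\<tau> x)
      show "s x - 8 * R\<^sup>2 * ((c x)\<^sup>2 / 8) \<le> 0"
        using s_le x by simp
    qed
    then show ?thesis by (simp add: \<sigma>_def \<tau>_def)
  qed
  have exp_ge: "exp (16 * R\<^sup>2 * \<tau> t) \<ge> 2 * R\<^sup>2 * t" if "t \<ge> 0" for t
  proof -
    have "2 * R\<^sup>2 * t - exp (16 * R\<^sup>2 * \<tau> t) \<le> 2 * R\<^sup>2 * 0 - exp (16 * R\<^sup>2 * \<tau> 0)"
    proof (rule nonincreasing_of_nonpos_derivative[OF that])
      fix x assume x: "x \<in> {0..t}"
      show "((\<lambda>t. 2 * R\<^sup>2 * t - exp (16 * R\<^sup>2 * \<tau> t)) has_real_derivative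
          2 * R\<^sup>2 - exp (16 * R\<^sup>2 * \<tau> x) * (16 * R\<^sup>2 * ((c x)\<^sup>2 / 8))) (at x within {0..t})"
        by (auto intro!: derivative_eq_intros d\<tau>[OF x])
      have "1 \<le> exp (16 * R\<^sup>2 * \<tau> x - 2 * \<sigma> x)"
        using \<sigma>_le[of x] x by (auto simp: algebra_simps)
      also have "\<dots> = exp (16 * R\<^sup>2 * \<tau> x) * (c x)\<^sup>2"
        by (simp add: c_def power2_eq_square exp_add[symmetric])
      finally have "R\<^sup>2 * 1 \<le> R\<^sup>2 * (exp (16 * R\<^sup>2 * \<tau> x) * (c x)\<^sup>2)"
        by (rule mult_left_mono) simp
      then show "2 * R\<^sup>2 - exp (16 * R\<^sup>2 * \<tau> x) * (16 * R\<^sup>2 * ((c x)\<^sup>2 / 8)) \<le> 0"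
        by (simp add: mult_ac)
    qed
    then show ?thesis
      using exp_ge_zero[of "16 * R\<^sup>2 * \<tau> 0"] by linarith
  qed
  have "filterlim \<tau> at_top at_top"
    unfolding filterlim_at_top
  proof
    fix Z :: real
    have "\<tau> t \<ge> Z" if "t \<ge> exp (16 * R\<^sup>2 * Z) / (2 * R\<^sup>2)" for t
    proof -
      have "exp (16 * R\<^sup>2 * Z) \<le> 2 * R\<^sup>2 * t"
        using that R by (simp add: pos_divide_le_eq mult.commute)
      moreover have "t \<ge> 0"
        using that R by (meson divide_nonneg_nonneg exp_ge_zero order_trans zero_le_mult_iff
            zero_le_numeral zero_le_power2)
      ultimately have "exp (16 * R\<^sup>2 * Z) \<le> exp (16 * R\<^sup>2 * \<tau> t)"
        using exp_ge by (meson order_trans)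
      then show ?thesis using R by simp
    qed
    then show "eventually (\<lambda>t. \<tau> t \<ge> Z) at_top"
      using eventually_at_top_linorder by blast
  qed
  then show ?thesis
    using that[of c \<tau>] A_eq by (simp add: A'_def c_def)
qed

theorem lemma4p1:
  fixes A0 :: "real ^ 'n ^ 'n"
    and A Abar :: "real \<Rightarrow> real ^ 'n ^ 'n"
  assumes "trace A0 = 0"
    and "\<not> nilpotent_matrix A0"
    and "is_bracket_flow (\<lambda>t. lie_mu (A t)) (lie_mu A0)"
    and "is_neg_gradient_flow comm_functional Abar"
    and "Abar 0 = A0"
  shows "\<exists>L. ((\<lambda>t. A t /\<^sub>R norm (A t)) \<longlongrightarrow> L) at_top \<and>
             ((\<lambda>t. Abar t /\<^sub>R norm (Abar t)) \<longlongrightarrow> L) at_top"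
proof -
  obtain A' where A'0: "A' 0 = A0" and AA': "\<And>t. t \<ge> 0 \<Longrightarrow> A t = A' t"
    and der: "\<And>t. t \<ge> 0 \<Longrightarrow> (A' has_vector_derivative bracket_flow_rhs (A' t)) (at t within {0..})"
    using assms(3) by (auto simp: is_bracket_flow_def lie_mu_inject)
  obtain c \<tau> where c: "\<And>t. t \<ge> 0 \<Longrightarrow> c t > 0" and A'c: "\<And>t. t \<ge> 0 \<Longrightarrow> A' t = c t *\<^sub>R Abar (\<tau> t)"
    and \<tau>: "filterlim \<tau> at_top at_top"
    using bracket_flow_eq_rescaled_gradient_flow[OF der _ assms(4)] assms(1,5) A'0 by metis
  obtain L where L: "(Abar \<longlongrightarrow> L) at_top" "L \<noteq> 0"
    using neg_gradient_flow_converges[OF assms(4)] assms(2,5) by blast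
  have lim: "((\<lambda>t. Abar t /\<^sub>R norm (Abar t)) \<longlongrightarrow> L /\<^sub>R norm L) at_top"
    by (intro tendsto_intros L) (use L in simp)
  from filterlim_compose[OF this \<tau>]
  have "((\<lambda>t. A t /\<^sub>R norm (A t)) \<longlongrightarrow> L /\<^sub>R norm L) at_top"
  proof (rule Lim_transform_eventually)
    show "\<forall>\<^sub>F t in at_top. Abar (\<tau> t) /\<^sub>R norm (Abar (\<tau> t)) = A t /\<^sub>R norm (A t)"
      using eventually_ge_at_top[of 0]
    proof eventually_elim
      case (elim t)
      then show ?case
        using c[of t] by (simp add: AA' A'c)
    qed
  qed
  with lim show ?thesis by blast
qed

end
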